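(* Let $S$ be an inverse semigroup, and let $\mathrm{Hol}(S)$ be its holomorph, i.e. the set of pairs $(\alpha,\tau)$ where $\alpha:S\to S$ is a premorphism and $\tau:E(S)\to S$ is an order-preserving function with $(e\tau)(e\tau)^{-1}=e\alpha$ for all $e\in E(S)$. Then: (a) $\mathrm{Hol}(S)$, with the order, groupoid composition and monoid composition described in the context and in (b) and (c), is a monoidal groupoid (that is, an internal monoid) in the cartesian closed category of ordered groupoids. (b) The groupoid composition of $(\alpha,\tau)$ and $(\beta,\sigma)$ is given by $(\alpha,\tau)(\beta,\sigma)=(\alpha,\psi)$, defined when, for all $s\in S$, $s\beta=\big((ss^{-1})\tau\big)^{-1}(s\alpha)\big((s^{-1}s)\tau\big)$, and where $e\psi=(e\tau)(e\sigma)$ for all $e\in E(S)$. (c) The monoid composition of $(\alpha,\tau)$ and $(\beta,\sigma)$ is given by $(\alpha,\tau)\diamond(\beta,\sigma)=(\alpha\beta,\ \tau\beta+\sigma)$, where, for all $e\in E(S)$, $e(\tau\beta+\sigma)=\big((e\tau)\beta\big)\big(((e\tau)^{-1}(e\tau))\sigma\big)$. (d) There is a (right) monoid action of $(\mathrm{Hol}(S),\diamond)$ on $S$ defined, for all $s\in S$, by $s\lhd(\alpha,\tau)=(s\alpha)\big((s^{-1}s)\tau\big)$.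
   Context: Functions are written on the right and composed left to right. For an inverse semigroup $S$, $E(S)$ is its semilattice of idempotents, and $S$ carries the natural partial order ($s\le t$ iff $s=te$ for some $e\in E(S)$). A premorphism $\theta:S\to S$ is a function with $(ab)\theta\le (a\theta)(b\theta)$ for all $a,b\in S$. A groupoid is a small category in which every arrow is invertible, regarded as the set of its arrows with a partial composition; identities are identified with objects; $g\mathbf{d}=gg^{-1}$ and $g\mathbf{r}=g^{-1}g$. An ordered groupoid is a groupoid $G$ with a partial order $\le$ on $G$ such that: (OG1) $g\le h$ implies $g^{-1}\le h^{-1}$; (OG2) if $g_1\le g_2$, $h_1\le h_2$ and $g_1h_1$, $g_2h_2$ are defined then $g_1h_1\le g_2h_2$; (OG3) if $x$ is an identity with $x\le g\mathbf{d}$ there is a unique element $(x|g)$ with $(x|g)\mathbf{d}=x$ and $(x|g)\le g$. Morphisms of ordered groupoids are order-preserving functors; products are componentwise. An internal monoid in the category of ordered groupoids is an ordered groupoid $G$ with an associative unital multiplication $G\times G\to G$ that is an ordered functor. To an inverse semigroup $S$ corresponds the ordered groupoid $\vec S$: the set $S$ with the natural partial order and the composition $a\cdot b=ab$, defined when $a^{-1}a=bb^{-1}$. The ordered functors $\vec S\to\vec S$ are exactly the premorphisms of $S$. For ordered groupoids $A,B$, the groupoid $\mathsf{OGPD}(A,B)$ has as objects the ordered functors $f:A\to B$, and as arrows the pairs $(f,\tau)$ with $f$ an ordered functor and $\tau:\mathrm{obj}(A)\to B$ an order-preserving function with $(x\tau)\mathbf{d}=xf$; this is a natural transformation from $f$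 to the ordered functor $a\mapsto((a\mathbf{d})\tau)^{-1}(af)((a\mathbf{r})\tau)$. Groupoid composition is composition of natural transformations. The order is pointwise: $(f,\tau)\le(g,\sigma)$ iff $af\le ag$ for all $a\in A$ and $x\tau\le x\sigma$ for all $x\in\mathrm{obj}(A)$. The monoid composition on $\mathsf{OGPD}(A,A)$ is $(f,\tau)\diamond(g,\sigma)=(fg,\phi)$ with $x\phi=((x\tau)g)\,(((x\tau)\mathbf{r})\sigma)$. The holomorph is $\mathrm{Hol}(S)=\mathsf{OGPD}(\vec S,\vec S)$ with these structures. *)

theory Defs
  imports "HOL-Algebra.Group"
begin

section \<open>Inverse semigroups\<close>

record 'a semigrp = "'a partial_object" +
  sgmult :: "'a \<Rightarrow> 'a \<Rightarrow> 'a" (infixl \<open>\<cdot>\<index>\<close> 70)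

locale inverse_semigroup =
  fixes S :: "'a semigrp" (structure)
  assumes mult_closed: "a \<in> carrier S \<Longrightarrow> b \<in> carrier S \<Longrightarrow> a \<cdot> b \<in> carrier S"
    and mult_assoc: "a \<in> carrier S \<Longrightarrow> b \<in> carrier S \<Longrightarrow> c \<in> carrier S \<Longrightarrow>
      (a \<cdot> b) \<cdot> c = a \<cdot> (b \<cdot> c)"
    and ex1_inverse: "a \<in> carrier S \<Longrightarrow>
      \<exists>!b. b \<in> carrier S \<and> a \<cdot> b \<cdot> a = a \<and> b \<cdot> a \<cdot> b = b"

definition sinv :: "'a semigrp \<Rightarrow> 'a \<Rightarrow> 'a" (\<open>sinv\<index> _\<close> [81] 80)
  where "sinv\<^bsub>S\<^esub> a =
    (THE b. b \<in> carrier S \<and> a \<cdot>\<^bsub>S\<^esub> b \<cdot>\<^bsub>S\<^esub> a = a \<and> b \<cdot>\<^bsub>S\<^esub> a \<cdot>\<^bsub>S\<^esub> b = b)"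

definition idems :: "'a semigrp \<Rightarrow> 'a set"
  where "idems S = {e \<in> carrier S. e \<cdot>\<^bsub>S\<^esub> e = e}"

definition nat_le :: "'a semigrp \<Rightarrow> 'a \<Rightarrow> 'a \<Rightarrow> bool" (infix \<open>\<preceq>\<index>\<close> 50)
  where "s \<preceq>\<^bsub>S\<^esub> t \<longleftrightarrow> (\<exists>e\<in>idems S. s = t \<cdot>\<^bsub>S\<^esub> e)"

definition premorphism :: "'a semigrp \<Rightarrow> ('a \<Rightarrow> 'a) \<Rightarrow> bool"
  where "premorphism S \<theta> \<longleftrightarrow> \<theta> \<in> carrier S \<rightarrow> carrier S \<and>
    (\<forall>a\<in>carrier S. \<forall>b\<in>carrier S. \<theta> (a \<cdot>\<^bsub>S\<^esub> b) \<preceq>\<^bsub>S\<^esub> \<theta> a \<cdot>\<^bsub>S\<^esub> \<theta> b)"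


section \<open>Ordered groupoids\<close>

text \<open>
  A groupoid is its set of arrows, with objects identified with identity arrows.
  Arrows compose from left to right: \<open>cmp G g h\<close> is meaningful only when
  \<open>tgt G g = src G h\<close>, and its value is irrelevant otherwise.
\<close>

record 'a ogpd =
  arr :: "'a set"
  src :: "'a \<Rightarrow> 'a"
  tgt :: "'a \<Rightarrow> 'a"
  cmp :: "'a \<Rightarrow> 'a \<Rightarrow> 'a"
  ole :: "'a \<Rightarrow> 'a \<Rightarrow> bool"

definition obj :: "'a ogpd \<Rightarrow> 'a set"
  where "obj G = {x \<in> arr G. src G x = x}"

definition is_ginv :: "'a ogpd \<Rightarrow> 'a \<Rightarrow> 'a \<Rightarrow> bool"
  where "is_ginv G g h \<longleftrightarrow> h \<in> arr G \<and> src G h = tgt G g \<and> tgt G h = src G g \<and>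
    cmp G g h = src G g \<and> cmp G h g = tgt G g"

definition ginv :: "'a ogpd \<Rightarrow> 'a \<Rightarrow> 'a"
  where "ginv G g = (THE h. is_ginv G g h)"

locale groupoid =
  fixes G :: "'a ogpd"
  assumes src_closed: "g \<in> arr G \<Longrightarrow> src G g \<in> arr G"
    and tgt_closed: "g \<in> arr G \<Longrightarrow> tgt G g \<in> arr G"
    and src_src: "g \<in> arr G \<Longrightarrow> src G (src G g) = src G g"
    and tgt_src: "g \<in> arr G \<Longrightarrow> tgt G (src G g) = src G g"
    and src_tgt: "g \<in> arr G \<Longrightarrow> src G (tgt G g) = tgt G g"
    and tgt_tgt: "g \<in> arr G \<Longrightarrow> tgt G (tgt G g) = tgt G g"
    and cmp_closed: "g \<in> arr G \<Longrightarrow> h \<in> arr G \<Longrightarrow> tgt G g = src G h \<Longrightarrow> cmp G g h \<in> arr G"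
    and src_cmp: "g \<in> arr G \<Longrightarrow> h \<in> arr G \<Longrightarrow> tgt G g = src G h \<Longrightarrow>
      src G (cmp G g h) = src G g"
    and tgt_cmp: "g \<in> arr G \<Longrightarrow> h \<in> arr G \<Longrightarrow> tgt G g = src G h \<Longrightarrow>
      tgt G (cmp G g h) = tgt G h"
    and cmp_assoc: "g \<in> arr G \<Longrightarrow> h \<in> arr G \<Longrightarrow> k \<in> arr G \<Longrightarrow>
      tgt G g = src G h \<Longrightarrow> tgt G h = src G k \<Longrightarrow>
      cmp G (cmp G g h) k = cmp G g (cmp G h k)"
    and cmp_src: "g \<in> arr G \<Longrightarrow> cmp G (src G g) g = g"
    and cmp_tgt: "g \<in> arr G \<Longrightarrow> cmp G g (tgt G g) = g"
    and ex_ginv: "g \<in> arr G \<Longrightarrow> \<exists>h. is_ginv G g h"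

locale ordered_groupoid = groupoid +
  assumes ole_partial_order:
      "partial_order_on (arr G) {(g, h). g \<in> arr G \<and> h \<in> arr G \<and> ole G g h}"
    and OG1: "g \<in> arr G \<Longrightarrow> h \<in> arr G \<Longrightarrow> ole G g h \<Longrightarrow> ole G (ginv G g) (ginv G h)"
    and OG2: "g1 \<in> arr G \<Longrightarrow> g2 \<in> arr G \<Longrightarrow> h1 \<in> arr G \<Longrightarrow> h2 \<in> arr G \<Longrightarrow>
      ole G g1 g2 \<Longrightarrow> ole G h1 h2 \<Longrightarrow> tgt G g1 = src G h1 \<Longrightarrow> tgt G g2 = src G h2 \<Longrightarrow>
      ole G (cmp G g1 h1) (cmp G g2 h2)"
    and OG3: "x \<in> obj G \<Longrightarrow> g \<in> arr G \<Longrightarrow> ole G x (src G g) \<Longrightarrow>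
      \<exists>!h. h \<in> arr G \<and> src G h = x \<and> ole G h g"

definition ordered_functor :: "'a ogpd \<Rightarrow> 'b ogpd \<Rightarrow> ('a \<Rightarrow> 'b) \<Rightarrow> bool"
  where "ordered_functor A B f \<longleftrightarrow> f \<in> arr A \<rightarrow> arr B \<and>
    (\<forall>a\<in>arr A. f (src A a) = src B (f a) \<and> f (tgt A a) = tgt B (f a)) \<and>
    (\<forall>a\<in>arr A. \<forall>b\<in>arr A. tgt A a = src A b \<longrightarrow> f (cmp A a b) = cmp B (f a) (f b)) \<and>
    (\<forall>a\<in>arr A. \<forall>b\<in>arr A. ole A a b \<longrightarrow> ole B (f a) (f b))"

definition prod_ogpd :: "'a ogpd \<Rightarrow> 'b ogpd \<Rightarrow> ('a \<times> 'b) ogpd"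
  where "prod_ogpd A B =
    \<lparr>arr = arr A \<times> arr B,
     src = (\<lambda>(a, b). (src A a, src B b)),
     tgt = (\<lambda>(a, b). (tgt A a, tgt B b)),
     cmp = (\<lambda>(a, b) (a', b'). (cmp A a a', cmp B b b')),
     ole = (\<lambda>(a, b) (a', b'). ole A a a' \<and> ole B b b')\<rparr>"

text \<open>
  The unit of an internal monoid is a morphism from the terminal ordered groupoid,
  that is, an identity arrow of \<open>G\<close>.
\<close>

definition internal_monoid :: "'a ogpd \<Rightarrow> 'a monoid \<Rightarrow> bool"
  where "internal_monoid G M \<longleftrightarrow>
    ordered_groupoid G \<and> monoid M \<and> carrier M = arr G \<and> \<one>\<^bsub>M\<^esub> \<in> obj G \<and>
    ordered_functor (prod_ogpd G G) G (\<lambda>(g, h). g \<otimes>\<^bsub>M\<^esub> h)"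

definition right_monoid_action :: "'m monoid \<Rightarrow> 'x set \<Rightarrow> ('x \<Rightarrow> 'm \<Rightarrow> 'x) \<Rightarrow> bool"
  where "right_monoid_action M X act \<longleftrightarrow> monoid M \<and>
    (\<forall>x\<in>X. \<forall>m\<in>carrier M. act x m \<in> X) \<and>
    (\<forall>x\<in>X. act x \<one>\<^bsub>M\<^esub> = x) \<and>
    (\<forall>x\<in>X. \<forall>m\<in>carrier M. \<forall>n\<in>carrier M. act x (m \<otimes>\<^bsub>M\<^esub> n) = act (act x m) n)"


section \<open>The exponential of ordered groupoids\<close>

definition nt_target :: "'a ogpd \<Rightarrow> 'b ogpd \<Rightarrow> ('a \<Rightarrow> 'b) \<Rightarrow> ('a \<Rightarrow> 'b) \<Rightarrow> 'a \<Rightarrow> 'b"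
  where "nt_target A B f \<tau> =
    (\<lambda>a\<in>arr A. cmp B (cmp B (ginv B (\<tau> (src A a))) (f a)) (\<tau> (tgt A a)))"

text \<open>
  Functions are taken extensional (\<open>undefined\<close> off their domain), so that equality of
  pairs is equality of functions on the domain. The functor \<open>f\<close>, as an object, is
  the identity arrow \<open>(f, restrict f (obj A))\<close>.
\<close>

definition OGPD :: "'a ogpd \<Rightarrow> 'b ogpd \<Rightarrow> (('a \<Rightarrow> 'b) \<times> ('a \<Rightarrow> 'b)) ogpd"
  where "OGPD A B =
    \<lparr>arr = {(f, \<tau>). f \<in> extensional (arr A) \<and> ordered_functor A B f \<and>
        \<tau> \<in> obj A \<rightarrow>\<^sub>E arr B \<and>
        (\<forall>x\<in>obj A. \<forall>y\<in>obj A. ole A x y \<longrightarrow> ole B (\<tau> x) (\<tau> y)) \<and>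
        (\<forall>x\<in>obj A. src B (\<tau> x) = f x)},
     src = (\<lambda>(f, \<tau>). (f, restrict f (obj A))),
     tgt = (\<lambda>(f, \<tau>). (nt_target A B f \<tau>, restrict (nt_target A B f \<tau>) (obj A))),
     cmp = (\<lambda>(f, \<tau>) (g, \<sigma>). (f, \<lambda>x\<in>obj A. cmp B (\<tau> x) (\<sigma> x))),
     ole = (\<lambda>(f, \<tau>) (g, \<sigma>). (\<forall>a\<in>arr A. ole B (f a) (g a)) \<and>
        (\<forall>x\<in>obj A. ole B (\<tau> x) (\<sigma> x)))\<rparr>"

text \<open>In the first component, \<open>f\<close> is applied first.\<close>

definition OGPD_monoid :: "'a ogpd \<Rightarrow> (('a \<Rightarrow> 'a) \<times> ('a \<Rightarrow> 'a)) monoid"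
  where "OGPD_monoid A =
    \<lparr>carrier = arr (OGPD A A),
     mult = (\<lambda>(f, \<tau>) (g, \<sigma>).
       (compose (arr A) g f, \<lambda>x\<in>obj A. cmp A (g (\<tau> x)) (\<sigma> (tgt A (\<tau> x))))),
     one = (\<lambda>a\<in>arr A. a, \<lambda>x\<in>obj A. x)\<rparr>"


section \<open>The holomorph of an inverse semigroup\<close>

definition vec_ogpd :: "'a semigrp \<Rightarrow> 'a ogpd"
  where "vec_ogpd S =
    \<lparr>arr = carrier S,
     src = (\<lambda>a. a \<cdot>\<^bsub>S\<^esub> sinv\<^bsub>S\<^esub> a),
     tgt = (\<lambda>a. sinv\<^bsub>S\<^esub> a \<cdot>\<^bsub>S\<^esub> a),
     cmp = (\<cdot>\<^bsub>S\<^esub>),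
     ole = (\<preceq>\<^bsub>S\<^esub>)\<rparr>"

definition Hol :: "'a semigrp \<Rightarrow> (('a \<Rightarrow> 'a) \<times> ('a \<Rightarrow> 'a)) ogpd"
  where "Hol S = OGPD (vec_ogpd S) (vec_ogpd S)"

definition Hol_monoid :: "'a semigrp \<Rightarrow> (('a \<Rightarrow> 'a) \<times> ('a \<Rightarrow> 'a)) monoid"
  where "Hol_monoid S = OGPD_monoid (vec_ogpd S)"

end

theory Submission
  imports Defs
begin

text \<open>
  The inverse semigroup \<open>S\<close> becomes an ordered groupoid in which \<open>(x|g) = x g\<close>. Since every
  product factors as a composable product \<open>ab = (ae)(eb)\<close> with
  \<open>e = a\<^sup>-\<^sup>1 a b b\<^sup>-\<^sup>1\<close>, the ordered functors of this groupoid are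
  the premorphisms of \<open>S\<close>. The rest holds for any ordered groupoid \<open>A\<close>: in \<open>OGPD A A\<close> all laws
  are checked pointwise, and the interchange law and the target of a product follow from
  naturality. The monoid acts on \<open>A\<close> through the diagonal of the naturality square.
\<close>

section \<open>Inverse semigroups\<close>

text \<open>The target of a pair is defined by conjugation, so direct computations would accumulate
  inverses. Cancelling \<open>\<tau> (src A a)\<close> on the left trades that formula for a
  naturality square without inverses, and compositions, inverses and products of transformations are
  handled by pasting or reversing such squares. Order arguments rest on another principle: an
  element below a given one is determined by its domain. This makes restriction monotone, and on the
  semigroup side it turns the inequality defining a premorphism into an equality on composable
  pairs, once inverses and domains are known to be preserved.\<close>

context inverse_semigroup
begin

lemma sinv_props:
  assumes "a \<in> carrier S"
  shows "sinv a \<in> carrier S" "a \<cdot> sinv a \<cdot> a = a" "sinv a \<cdot> a \<cdot> sinv a = sinv a"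
  using theI'[OF ex1_inverse[OF assms]] unfolding sinv_def by blast+

lemmas sinv_closed = sinv_props(1)

lemma sinv_unique:
  assumes "a \<in> carrier S" "b \<in> carrier S" "a \<cdot> b \<cdot> a = a" "b \<cdot> a \<cdot> b = b"
  shows "sinv a = b"
  using ex1_inverse[of a] sinv_props[of a] assms by blast

lemma mult_sinv_mult:
  assumes "a \<in> carrier S"
  shows "a \<cdot> (sinv a \<cdot> a) = a" "sinv a \<cdot> (a \<cdot> sinv a) = sinv a"
  using assms sinv_props[OF assms] by (simp_all add: mult_assoc)

text \<open>Since \<open>mult_assoc\<close> nests products to the right, the inverse laws must also
  be available in front of a further factor for simplification to find them.\<close>

lemma mult_sinv_mult_left:
  assumes "a \<in> carrier S" "b \<in> carrier S"
  shows "a \<cdot> (sinv a \<cdot> (a \<cdot> b)) = a \<cdot> b" "sinv a \<cdot> (a \<cdot> (sinv a \<cdot> b)) = sinv a \<cdot> b"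
  using assms sinv_props[OF assms(1)] by (metis mult_assoc mult_closed)+

lemma sinv_sinv: "a \<in> carrier S \<Longrightarrow> sinv (sinv a) = a"
  by (rule sinv_unique) (simp_all add: sinv_props)

section \<open>Idempotents and their commutation\<close>

lemma idems_closed: "e \<in> idems S \<Longrightarrow> e \<in> carrier S"
  by (simp add: idems_def)

lemma idems_mult_self: "e \<in> idems S \<Longrightarrow> e \<cdot> e = e"
  by (simp add: idems_def)

lemma idems_mult_self_left: "e \<in> idems S \<Longrightarrow> a \<in> carrier S \<Longrightarrow> e \<cdot> (e \<cdot> a) = e \<cdot> a"
  by (metis mult_assoc idems_closed idems_mult_self)

lemma sinv_idem: "e \<in> idems S \<Longrightarrow> sinv e = e"
  by (rule sinv_unique) (simp_all add: idems_def)

lemma mult_sinv_idem: "a \<in> carrier S \<Longrightarrow> a \<cdot> sinv a \<in> idems S"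
  and sinv_mult_idem: "a \<in> carrier S \<Longrightarrow> sinv a \<cdot> a \<in> idems S"
  by (simp_all add: idems_def mult_closed sinv_closed mult_assoc mult_sinv_mult mult_sinv_mult_left)

text \<open>The element \<open>f (ef)\<^sup>-\<^sup>1 e\<close> is an idempotent inverse of \<open>ef\<close>, so \<open>ef\<close> is idempotent.\<close>

lemma idems_mult_closed:
  assumes "e \<in> idems S" "f \<in> idems S"
  shows "e \<cdot> f \<in> idems S"
proof -
  note c = assms[THEN idems_closed]
  define x where "x = sinv (e \<cdot> f)"
  have x: "x \<in> carrier S" "e \<cdot> (f \<cdot> (x \<cdot> (e \<cdot> f))) = e \<cdot> f" "x \<cdot> (e \<cdot> (f \<cdot> x)) = x"
    using sinv_props[of "e \<cdot> f"] c by (simp_all add: x_def mult_assoc mult_closed)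
  define y where "y = f \<cdot> (x \<cdot> e)"
  have y: "y \<in> carrier S" using x c by (simp add: y_def mult_closed)
  have x': "x \<cdot> (e \<cdot> (f \<cdot> (x \<cdot> b))) = x \<cdot> b" if "b \<in> carrier S" for b
    using x c that by (metis mult_assoc mult_closed)
  have yy: "y \<in> idems S"
    using x x' c by (simp add: y_def idems_def mult_assoc mult_closed)
  have "sinv y = e \<cdot> f"
  proof (rule sinv_unique)
    show "y \<cdot> (e \<cdot> f) \<cdot> y = y"
      using x x' c assms by (simp add: y_def mult_assoc mult_closed idems_mult_self_left)
    show "e \<cdot> f \<cdot> y \<cdot> (e \<cdot> f) = e \<cdot> f"
      using x x' c assms by (simp add: y_def mult_assoc mult_closed idems_mult_self_left)
  qed (use y c in \<open>simp_all add: mult_closed\<close>)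
  then show ?thesis using sinv_idem[OF yy] yy by simp
qed

text \<open>Both \<open>e \<cdot> f\<close> and \<open>f \<cdot> e\<close> are idempotent, so
  \<open>f \<cdot> e\<close> is an inverse of \<open>e \<cdot> f\<close>; an idempotent is its own
  inverse, and uniqueness identifies the two.\<close>

lemma idems_commute:
  assumes "e \<in> idems S" "f \<in> idems S"
  shows "e \<cdot> f = f \<cdot> e"
proof -
  note c = assms[THEN idems_closed]
  have 1: "e \<cdot> (f \<cdot> (e \<cdot> f)) = e \<cdot> f" "f \<cdot> (e \<cdot> (f \<cdot> e)) = f \<cdot> e"
    using idems_mult_self[OF idems_mult_closed[OF assms]]
      idems_mult_self[OF idems_mult_closed[OF assms(2,1)]] c
    by (simp_all add: mult_assoc mult_closed)
  have "sinv (e \<cdot> f) = f \<cdot> e"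
    by (rule sinv_unique)
      (use 1 c assms in \<open>simp_all add: mult_assoc mult_closed idems_mult_self_left\<close>)
  then show ?thesis
    using sinv_idem[OF idems_mult_closed[OF assms]] by simp
qed

text \<open>Commuting the idempotents \<open>b \<cdot> sinv b\<close> and
  \<open>sinv a \<cdot> a\<close> in the middle of the product brings each letter next to its
  inverse.\<close>

lemma sinv_mult:
  assumes "a \<in> carrier S" "b \<in> carrier S"
  shows "sinv (a \<cdot> b) = sinv b \<cdot> sinv a"
proof (rule sinv_unique)
  note c = assms assms[THEN sinv_closed]
  have *: "b \<cdot> (sinv b \<cdot> (sinv a \<cdot> a)) = sinv a \<cdot> (a \<cdot> (b \<cdot> sinv b))"
    using idems_commute[OF mult_sinv_idem[of b] sinv_mult_idem[of a]] c
    by (simp add: mult_assoc mult_closed)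
  have *: "b \<cdot> (sinv b \<cdot> (sinv a \<cdot> (a \<cdot> d))) = sinv a \<cdot> (a \<cdot> (b \<cdot> (sinv b \<cdot> d)))"
    if "d \<in> carrier S" for d
    using arg_cong[OF *, of "\<lambda>u. u \<cdot> d"] c that by (simp add: mult_assoc mult_closed)
  show "a \<cdot> b \<cdot> (sinv b \<cdot> sinv a) \<cdot> (a \<cdot> b) = a \<cdot> b"
    using c * by (simp add: mult_assoc mult_closed mult_sinv_mult mult_sinv_mult_left)
  show "sinv b \<cdot> sinv a \<cdot> (a \<cdot> b) \<cdot> (sinv b \<cdot> sinv a) = sinv b \<cdot> sinv a"
    using c *[symmetric] by (simp add: mult_assoc mult_closed mult_sinv_mult mult_sinv_mult_left)
qed (use assms in \<open>simp_all add: mult_closed sinv_closed\<close>)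

text \<open>An idempotent can be moved past any element at the cost of conjugation. This converts
  left multiplication by an idempotent into the right-hand form that \<open>nat_le\<close>
  requires.\<close>

lemma conj_idem:
  assumes "a \<in> carrier S" "e \<in> idems S"
  shows "sinv a \<cdot> (e \<cdot> a) \<in> idems S" "a \<cdot> (sinv a \<cdot> (e \<cdot> a)) = e \<cdot> a"
proof -
  note c = assms idems_closed[OF assms(2)] sinv_closed[OF assms(1)]
  have "a \<cdot> sinv a \<cdot> e = e \<cdot> (a \<cdot> sinv a)"
    using idems_commute mult_sinv_idem c by simp
  then show 1: "a \<cdot> (sinv a \<cdot> (e \<cdot> a)) = e \<cdot> a"
    using c by (metis mult_assoc mult_closed mult_sinv_mult(1))
  show "sinv a \<cdot> (e \<cdot> a) \<in> idems S"
    using c 1 by (simp add: idems_def mult_assoc mult_closed idems_mult_self_left)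
qed

section \<open>The natural partial order\<close>

lemma nat_leI: "e \<in> idems S \<Longrightarrow> t \<cdot> e \<preceq> t"
  unfolding nat_le_def by blast

lemma nat_leI': "e \<in> idems S \<Longrightarrow> t \<in> carrier S \<Longrightarrow> e \<cdot> t \<preceq> t"
  using nat_leI[OF conj_idem(1), of t e t] conj_idem(2)[of t e] by simp

text \<open>The witness can be read off from \<open>s\<close>: it is \<open>sinv s \<cdot> s\<close>
  on the right and \<open>s \<cdot> sinv s\<close> on the left, which leaves equations without an
  existential.\<close>

lemma nat_leD:
  assumes "s \<preceq> t" "t \<in> carrier S"
  shows "t \<cdot> (sinv s \<cdot> s) = s" "s \<cdot> (sinv s \<cdot> t) = s"
proof -
  obtain e where e: "e \<in> idems S" and s: "s = t \<cdot> e"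
    using assms(1) unfolding nat_le_def by blast
  note c = assms(2) e idems_closed[OF e] sinv_closed[OF assms(2)]
  have comm: "e \<cdot> (sinv t \<cdot> t) = sinv t \<cdot> (t \<cdot> e)"
    using idems_commute[OF e sinv_mult_idem] c by (simp add: mult_assoc mult_closed)
  then have comm': "e \<cdot> (sinv t \<cdot> (t \<cdot> e)) = sinv t \<cdot> (t \<cdot> e)"
    using c by (metis mult_assoc mult_closed idems_mult_self)
  show "t \<cdot> (sinv s \<cdot> s) = s" "s \<cdot> (sinv s \<cdot> t) = s"
    unfolding s using c comm comm'
    by (simp_all add: mult_assoc mult_closed sinv_mult sinv_idem idems_mult_self
        idems_mult_self_left mult_sinv_mult mult_sinv_mult_left)
qed

lemma nat_le_refl: "a \<in> carrier S \<Longrightarrow> a \<preceq> a"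
  using nat_leI[OF sinv_mult_idem, of a a] mult_sinv_mult[of a] by simp

lemma nat_le_trans:
  assumes "a \<preceq> b" "b \<preceq> c" "c \<in> carrier S"
  shows "a \<preceq> c"
  using assms unfolding nat_le_def
  by (metis idems_closed idems_mult_closed mult_assoc)

lemma nat_le_antisym:
  assumes "a \<preceq> b" "b \<preceq> a" "a \<in> carrier S" "b \<in> carrier S"
  shows "a = b"
proof -
  obtain e f where ef: "e \<in> idems S" "f \<in> idems S" and a: "a = b \<cdot> e" and b: "b = a \<cdot> f"
    using assms unfolding nat_le_def by blast
  have "a = a \<cdot> (f \<cdot> e)" using a b ef assms by (metis mult_assoc idems_closed)
  \<comment> \<open>Commutation allows \<open>f\<close> to be repeated, after which the product
    collapses from the left: \<open>a \<cdot> f\<close> is \<open>b\<close>,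
    \<open>b \<cdot> e\<close> is \<open>a\<close>, and \<open>a \<cdot> f\<close> is
    \<open>b\<close>.\<close>
  also have "\<dots> = a \<cdot> f \<cdot> e \<cdot> f"
    using idems_commute[OF ef] ef assms
    by (simp add: mult_assoc mult_closed idems_closed idems_mult_self idems_mult_self_left)
  also have "\<dots> = b" using a b by simp
  finally show ?thesis .
qed

text \<open>Inverting \<open>b \<cdot> e\<close> puts the idempotent on the left, where
  \<open>nat_leI'\<close> applies.\<close>

lemma nat_le_sinv:
  assumes "a \<preceq> b" "b \<in> carrier S"
  shows "sinv a \<preceq> sinv b"
  using assms nat_leI'[OF _ sinv_closed] unfolding nat_le_def[of S a b]
  by (auto simp: sinv_mult idems_closed sinv_idem)

lemma nat_le_mult:
  assumes "a \<preceq> b" "c \<preceq> d" "b \<in> carrier S" "d \<in> carrier S"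
  shows "a \<cdot> c \<preceq> b \<cdot> d"
proof -
  obtain e f where ef: "e \<in> idems S" "f \<in> idems S" and a: "a = b \<cdot> e" and c: "c = d \<cdot> f"
    using assms unfolding nat_le_def by blast
  \<comment> \<open>Conjugation by \<open>d\<close> moves \<open>e\<close> to its right:
    \<open>e \<cdot> d = d \<cdot> (sinv d \<cdot> (e \<cdot> d))\<close>.\<close>
  have "a \<cdot> c = b \<cdot> d \<cdot> (sinv d \<cdot> (e \<cdot> d) \<cdot> f)"
    using a c ef assms conj_idem(2)[OF assms(4) ef(1)]
    by (metis (no_types, lifting) idems_closed mult_assoc mult_closed sinv_closed)
  then show ?thesis
    using nat_leI idems_mult_closed conj_idem assms ef by metis
qed

text \<open>By \<open>nat_leD\<close>, \<open>s = s \<cdot> sinv s \<cdot> t = t \<cdot> sinv t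
  \<cdot> t = t\<close>. This is how inequalities are upgraded to equalities.\<close>

lemma nat_le_eq_domain:
  assumes "s \<preceq> t" "s \<cdot> sinv s = t \<cdot> sinv t" "s \<in> carrier S" "t \<in> carrier S"
  shows "s = t"
  using assms nat_leD(2)[OF assms(1,4)]
  by (metis mult_assoc mult_sinv_mult(1) sinv_closed)

lemma nat_le_idem_mult: "e \<in> idems S \<Longrightarrow> f \<in> idems S \<Longrightarrow> e \<preceq> f \<Longrightarrow> e \<cdot> f = e"
  using nat_leD(2)[of e f] by (simp add: sinv_idem idems_closed idems_mult_self_left)

text \<open>Exchanging \<open>b \<cdot> sinv b\<close> and \<open>sinv a \<cdot> a\<close> lets the
  inner factors cancel; these are the domain and range laws of the groupoid.\<close>

lemma composable_simps:
  assumes "a \<in> carrier S" "b \<in> carrier S" "sinv a \<cdot> a = b \<cdot> sinv b"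
  shows "a \<cdot> b \<cdot> sinv (a \<cdot> b) = a \<cdot> sinv a" "sinv (a \<cdot> b) \<cdot> (a \<cdot> b) = sinv b \<cdot> b"
proof -
  note c = assms assms(1,2)[THEN sinv_closed]
  have 1: "b \<cdot> (sinv b \<cdot> d) = sinv a \<cdot> (a \<cdot> d)" if "d \<in> carrier S" for d
    using assms(3) c that by (metis mult_assoc)
  show "a \<cdot> b \<cdot> sinv (a \<cdot> b) = a \<cdot> sinv a"
    using c 1 by (simp add: mult_assoc mult_closed sinv_mult mult_sinv_mult mult_sinv_mult_left)
  show "sinv (a \<cdot> b) \<cdot> (a \<cdot> b) = sinv b \<cdot> b"
    using c 1[symmetric]
    by (simp add: mult_assoc mult_closed sinv_mult mult_sinv_mult mult_sinv_mult_left)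
qed


section \<open>The ordered groupoid of an inverse semigroup\<close>

lemma vec_sel:
  "arr (vec_ogpd S) = carrier S" "src (vec_ogpd S) = (\<lambda>a. a \<cdot> sinv a)"
  "tgt (vec_ogpd S) = (\<lambda>a. sinv a \<cdot> a)" "cmp (vec_ogpd S) = (\<cdot>)" "ole (vec_ogpd S) = (\<preceq>)"
  by (simp_all add: vec_ogpd_def)

lemma obj_vec: "obj (vec_ogpd S) = idems S"
  unfolding obj_def vec_sel
  using mult_sinv_idem by (auto simp: idems_closed sinv_idem idems_mult_self) metis

lemma groupoid_vec: "groupoid (vec_ogpd S)"
proof (unfold_locales, unfold vec_sel)
  fix g assume g: "g \<in> carrier S"
  show "\<exists>h. is_ginv (vec_ogpd S) g h"
    by (rule exI[of _ "sinv g"]) (simp add: is_ginv_def vec_sel g sinv_closed sinv_sinv)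
qed (simp_all add: mult_closed sinv_closed composable_simps mult_sinv_idem sinv_mult_idem
      sinv_idem idems_mult_self sinv_props mult_sinv_mult, simp add: mult_assoc)

end

section \<open>Ordered groupoids\<close>

context groupoid
begin

lemma is_ginv_unique:
  assumes g: "g \<in> arr G" and h: "is_ginv G g h" and k: "is_ginv G g k"
  shows "h = k"
proof -
  have "h = cmp G h (cmp G g k)"
    using h k cmp_tgt[of h] unfolding is_ginv_def by metis
  also have "\<dots> = cmp G (cmp G h g) k"
    using g h k cmp_assoc[of h g k] unfolding is_ginv_def by metis
  also have "\<dots> = k"
    using h k cmp_src[of k] unfolding is_ginv_def by metis
  finally show ?thesis .
qed

lemma ginv_eqI: "g \<in> arr G \<Longrightarrow> is_ginv G g h \<Longrightarrow> ginv G g = h"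
  unfolding ginv_def using is_ginv_unique by blast

lemma is_ginv_ginv: "g \<in> arr G \<Longrightarrow> is_ginv G g (ginv G g)"
  using ex_ginv ginv_eqI by metis

lemma ginv_props:
  assumes "g \<in> arr G"
  shows "ginv G g \<in> arr G" "src G (ginv G g) = tgt G g" "tgt G (ginv G g) = src G g"
    "cmp G g (ginv G g) = src G g" "cmp G (ginv G g) g = tgt G g"
  using is_ginv_ginv[OF assms] unfolding is_ginv_def by auto

lemma cmp_ginv_cancel:
  assumes "g \<in> arr G" "h \<in> arr G"
  shows "tgt G g = src G h \<Longrightarrow> cmp G (ginv G g) (cmp G g h) = h"
    and "src G g = src G h \<Longrightarrow> cmp G g (cmp G (ginv G g) h) = h"
  using assms ginv_props[OF assms(1)] cmp_assoc[of "ginv G g" g h] cmp_assoc[of g "ginv G g" h]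
    cmp_src[of h] by auto

lemma objD: "x \<in> obj G \<Longrightarrow> x \<in> arr G" "x \<in> obj G \<Longrightarrow> src G x = x" "x \<in> obj G \<Longrightarrow> tgt G x = x"
  using tgt_src unfolding obj_def by (auto, metis)

lemma src_obj: "g \<in> arr G \<Longrightarrow> src G g \<in> obj G" and tgt_obj: "g \<in> arr G \<Longrightarrow> tgt G g \<in> obj G"
  unfolding obj_def by (simp_all add: src_closed tgt_closed src_src src_tgt)

lemmas groupoid_simps = src_closed tgt_closed src_src tgt_src src_tgt tgt_tgt cmp_closed src_cmp
  tgt_cmp cmp_src cmp_tgt ginv_props objD src_obj tgt_obj

end

context ordered_groupoid
begin

lemma ole_refl: "g \<in> arr G \<Longrightarrow> ole G g g"
  using ole_partial_order unfolding partial_order_on_def preorder_on_def refl_on_def by blast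

lemma ole_trans:
  "\<lbrakk>ole G g h; ole G h k; g \<in> arr G; h \<in> arr G; k \<in> arr G\<rbrakk> \<Longrightarrow> ole G g k"
  using ole_partial_order unfolding partial_order_on_def preorder_on_def trans_def by blast

lemma ole_antisym: "\<lbrakk>ole G g h; ole G h g; g \<in> arr G; h \<in> arr G\<rbrakk> \<Longrightarrow> g = h"
  using ole_partial_order unfolding partial_order_on_def antisym_def by blast

text \<open>The source of \<open>g\<close> is the composite of \<open>g\<close> with its inverse, so
  OG1 and OG2 apply; the target is treated in the same way.\<close>

lemma ole_src: "\<lbrakk>ole G g h; g \<in> arr G; h \<in> arr G\<rbrakk> \<Longrightarrow> ole G (src G g) (src G h)"
  using OG2[of g h "ginv G g" "ginv G h"] OG1[of g h] by (simp add: groupoid_simps)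

lemma ole_tgt: "\<lbrakk>ole G g h; g \<in> arr G; h \<in> arr G\<rbrakk> \<Longrightarrow> ole G (tgt G g) (tgt G h)"
  using OG2[of "ginv G g" "ginv G h" g h] OG1[of g h] by (simp add: groupoid_simps)

text \<open>This is \<open>(x|g)\<close> of OG3, meaningful only for an identity \<open>x\<close>
  below \<open>src G g\<close>.\<close>

definition restriction :: "'a \<Rightarrow> 'a \<Rightarrow> 'a"
  where "restriction x g = (THE h. h \<in> arr G \<and> src G h = x \<and> ole G h g)"

lemma restriction_props:
  assumes "x \<in> obj G" "g \<in> arr G" "ole G x (src G g)"
  shows "restriction x g \<in> arr G" "src G (restriction x g) = x" "ole G (restriction x g) g"
  using theI'[OF OG3[OF assms]] unfolding restriction_def by auto

text \<open>Both \<open>h\<close> and \<open>k\<close> are restrictions of \<open>g\<close> to their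
  common domain, which lies below \<open>src G g\<close>, so OG3 identifies them.\<close>

lemma ole_eq_src:
  assumes "ole G h g" "ole G k g" "src G h = src G k" "g \<in> arr G" "h \<in> arr G" "k \<in> arr G"
  shows "h = k"
  using OG3[of "src G h" g] assms ole_src[of h g] src_obj by metis

text \<open>Restricting \<open>restriction y h\<close> further to \<open>x\<close> gives an element
  below \<open>h\<close> with domain \<open>x\<close>, and \<open>restriction x g\<close> is
  another; uniqueness identifies them, and the former lies below
  \<open>restriction y h\<close>.\<close>

lemma restriction_mono:
  assumes "x \<in> obj G" "g \<in> arr G" "ole G x (src G g)"
    and "y \<in> obj G" "h \<in> arr G" "ole G y (src G h)"
    and "ole G x y" "ole G g h"
  shows "ole G (restriction x g) (restriction y h)"
proof -
  let ?r = "restriction y h"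
  note r = restriction_props[OF assms(1-3)] restriction_props[OF assms(4-6)]
  have x: "ole G x (src G ?r)" using r assms by simp
  note q = restriction_props[OF assms(1) r(4) x]
  have "restriction x ?r = restriction x g"
  proof (rule ole_eq_src)
    show "ole G (restriction x ?r) h"
      by (rule ole_trans[OF q(3) r(6)]) (use q r assms in simp_all)
    show "ole G (restriction x g) h"
      by (rule ole_trans[OF r(3) assms(8)]) (use r assms in simp_all)
  qed (use q r assms in simp_all)
  then show ?thesis using q by simp
qed

end

context inverse_semigroup
begin

lemma ginv_vec: "a \<in> carrier S \<Longrightarrow> ginv (vec_ogpd S) a = sinv a"
  by (rule groupoid.ginv_eqI[OF groupoid_vec])
    (simp_all add: is_ginv_def vec_sel sinv_closed sinv_sinv)

lemma ordered_groupoid_vec: "ordered_groupoid (vec_ogpd S)"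
proof -
  interpret groupoid "vec_ogpd S" by (rule groupoid_vec)
  show ?thesis
  proof (unfold_locales, unfold vec_sel obj_vec)
    show "partial_order_on (carrier S) {(g, h). g \<in> carrier S \<and> h \<in> carrier S \<and> g \<preceq> h}"
      unfolding partial_order_on_def preorder_on_def refl_on_def antisym_def trans_def
      using nat_le_refl nat_le_trans nat_le_antisym by blast
  next
    fix x g assume x: "x \<in> idems S" and g: "g \<in> carrier S" and le: "x \<preceq> g \<cdot> sinv g"
    note c = x g idems_closed[OF x] sinv_closed[OF g]
    have "x \<cdot> (g \<cdot> sinv g) = x"
      using nat_le_idem_mult[OF x mult_sinv_idem[OF g] le] .
    then have "x \<cdot> g \<cdot> sinv (x \<cdot> g) = x"
      using c by (metis mult_assoc mult_closed sinv_mult sinv_idem idems_mult_self)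
    moreover have "x \<cdot> g \<preceq> g" using nat_leI'[OF x g] .
    \<comment> \<open>An element \<open>h\<close> below \<open>g\<close> satisfies
      \<open>h = h \<cdot> sinv h \<cdot> g\<close>, which forces the value
      \<open>x \<cdot> g\<close>.\<close>
    moreover have "h = x \<cdot> g" if "h \<in> carrier S" "h \<cdot> sinv h = x" "h \<preceq> g" for h
      using that nat_leD(2)[OF that(3) g] c by (metis mult_assoc sinv_closed)
    ultimately show "\<exists>!h. h \<in> carrier S \<and> h \<cdot> sinv h = x \<and> h \<preceq> g"
      using mult_closed[OF c(3,2)] by blast
  qed (simp_all add: ginv_vec nat_le_sinv nat_le_mult)
qed

end

section \<open>Ordered functors\<close>

lemma ordered_functorI:
  assumes "\<And>a. a \<in> arr A \<Longrightarrow> f a \<in> arr B"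
    and "\<And>a. a \<in> arr A \<Longrightarrow> f (src A a) = src B (f a)"
    and "\<And>a. a \<in> arr A \<Longrightarrow> f (tgt A a) = tgt B (f a)"
    and "\<And>a b. a \<in> arr A \<Longrightarrow> b \<in> arr A \<Longrightarrow> tgt A a = src A b \<Longrightarrow>
      f (cmp A a b) = cmp B (f a) (f b)"
    and "\<And>a b. a \<in> arr A \<Longrightarrow> b \<in> arr A \<Longrightarrow> ole A a b \<Longrightarrow> ole B (f a) (f b)"
  shows "ordered_functor A B f"
  using assms unfolding ordered_functor_def by blast

lemma ordered_functorD:
  assumes "ordered_functor A B f"
  shows "a \<in> arr A \<Longrightarrow> f a \<in> arr B"
    and "a \<in> arr A \<Longrightarrow> f (src A a) = src B (f a)"
    and "a \<in> arr A \<Longrightarrow> f (tgt A a) = tgt B (f a)"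
    and "\<lbrakk>a \<in> arr A; b \<in> arr A; tgt A a = src A b\<rbrakk> \<Longrightarrow> f (cmp A a b) = cmp B (f a) (f b)"
    and "\<lbrakk>a \<in> arr A; b \<in> arr A; ole A a b\<rbrakk> \<Longrightarrow> ole B (f a) (f b)"
  using assms unfolding ordered_functor_def by auto

context inverse_semigroup
begin

lemma ordered_functor_iff_premorphism:
  "ordered_functor (vec_ogpd S) (vec_ogpd S) \<theta> \<longleftrightarrow> premorphism S \<theta>"
proof
  assume f: "ordered_functor (vec_ogpd S) (vec_ogpd S) \<theta>"
  note fD = ordered_functorD[OF f, unfolded vec_sel]
  show "premorphism S \<theta>"
    unfolding premorphism_def
  proof (intro conjI ballI)
    show "\<theta> \<in> carrier S \<rightarrow> carrier S" using fD(1) by blast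
    fix a b assume a: "a \<in> carrier S" and b: "b \<in> carrier S"
    \<comment> \<open>This is the meet of the range idempotent of \<open>a\<close> and the domain
      idempotent of \<open>b\<close>, hence the largest object to which both can be
      restricted.\<close>
    define e where "e = sinv a \<cdot> a \<cdot> (b \<cdot> sinv b)"
    note i = sinv_mult_idem[OF a] mult_sinv_idem[OF b]
    have e: "e \<in> idems S" unfolding e_def using i by (rule idems_mult_closed)
    note c = a b sinv_closed[OF a] sinv_closed[OF b] idems_closed[OF e]
    have 1: "sinv a \<cdot> a \<cdot> e = e" "e \<cdot> (b \<cdot> sinv b) = e"
      unfolding e_def using c by (simp_all add: mult_assoc mult_closed mult_sinv_mult
          mult_sinv_mult_left)
    have t: "sinv (a \<cdot> e) \<cdot> (a \<cdot> e) = e"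
    proof -
      have "sinv (a \<cdot> e) \<cdot> (a \<cdot> e) = e \<cdot> (sinv a \<cdot> a \<cdot> e)"
        using c e by (simp add: sinv_mult sinv_idem mult_assoc mult_closed)
      then show ?thesis using 1 e by (simp add: idems_mult_self)
    qed
    have s: "e \<cdot> b \<cdot> sinv (e \<cdot> b) = e"
    proof -
      have "e \<cdot> b \<cdot> sinv (e \<cdot> b) = e \<cdot> (b \<cdot> sinv b) \<cdot> e"
        using c e by (simp add: sinv_mult sinv_idem mult_assoc mult_closed)
      then show ?thesis using 1 e by (simp add: idems_mult_self)
    qed
    have "a \<cdot> e \<cdot> (e \<cdot> b) = a \<cdot> (e \<cdot> b)"
      using c e by (simp add: mult_assoc mult_closed idems_mult_self_left)
    also have "\<dots> = a \<cdot> b"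
      unfolding e_def using c
      by (simp add: mult_assoc mult_closed mult_sinv_mult mult_sinv_mult_left)
    finally have "\<theta> (a \<cdot> b) = \<theta> (a \<cdot> e) \<cdot> \<theta> (e \<cdot> b)"
      using fD(4)[of "a \<cdot> e" "e \<cdot> b"] s t c by (simp add: mult_closed)
    also have "\<dots> \<preceq> \<theta> a \<cdot> \<theta> b"
      using c e by (intro nat_le_mult fD) (simp_all add: mult_closed nat_leI nat_leI')
    finally show "\<theta> (a \<cdot> b) \<preceq> \<theta> a \<cdot> \<theta> b" .
  qed
next
  assume p: "premorphism S \<theta>"
  have cl: "\<theta> a \<in> carrier S" if "a \<in> carrier S" for a
    using p that unfolding premorphism_def by blast
  have le: "\<theta> (a \<cdot> b) \<preceq> \<theta> a \<cdot> \<theta> b" if "a \<in> carrier S" "b \<in> carrier S" for a b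
    using p that unfolding premorphism_def by blast
  have le3: "\<theta> (a \<cdot> b \<cdot> c) \<preceq> \<theta> a \<cdot> \<theta> b \<cdot> \<theta> c"
    if "a \<in> carrier S" "b \<in> carrier S" "c \<in> carrier S" for a b c
    using nat_le_trans[OF le nat_le_mult[OF le nat_le_refl]] that
    by (simp add: mult_closed cl)
  \<comment> \<open>The order gives
    \<open>x = x \<cdot> (sinv x \<cdot> (x \<cdot> y \<cdot> x))\<close>, which cancels to
    \<open>x \<cdot> y \<cdot> x\<close>. With \<open>x\<close> and \<open>y\<close> the images of
    \<open>a\<close> and \<open>sinv a\<close>, in either order, this makes the two images mutually
    inverse.\<close>
  have absorb: "x \<cdot> y \<cdot> x = x" if "x \<preceq> x \<cdot> y \<cdot> x" "x \<in> carrier S" "y \<in> carrier S" for x y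
    using nat_leD(2)[OF that(1)] that
    by (simp add: mult_assoc mult_closed sinv_closed mult_sinv_mult_left)
  have inv: "\<theta> (sinv a) = sinv (\<theta> a)" if a: "a \<in> carrier S" for a
  proof (rule sinv_unique[symmetric])
    show "\<theta> a \<cdot> \<theta> (sinv a) \<cdot> \<theta> a = \<theta> a"
      using le3[of a "sinv a" a] a by (intro absorb) (simp_all add: cl sinv_closed sinv_props)
    show "\<theta> (sinv a) \<cdot> \<theta> a \<cdot> \<theta> (sinv a) = \<theta> (sinv a)"
      using le3[of "sinv a" a "sinv a"] a
      by (intro absorb) (simp_all add: cl sinv_closed sinv_props)
  qed (simp_all add: a cl sinv_closed)
  have idem: "\<theta> e \<in> idems S" if e: "e \<in> idems S" for e
    using le[of e e] nat_leD(2)[of "\<theta> e" "\<theta> e \<cdot> \<theta> e"] e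
    by (simp add: idems_def cl mult_closed mult_sinv_mult_left)
  \<comment> \<open>One inequality is the premorphism law for \<open>a\<close> and
    \<open>sinv a\<close>. The other starts from the factorization
    \<open>a = (a \<cdot> sinv a) \<cdot> a\<close> and multiplies on the right by
    \<open>sinv (\<theta> a)\<close>.\<close>
  have src: "\<theta> (a \<cdot> sinv a) = \<theta> a \<cdot> sinv (\<theta> a)" if a: "a \<in> carrier S" for a
  proof (rule nat_le_antisym)
    note c = a sinv_closed[OF a] cl[OF a] sinv_closed[OF cl[OF a]]
    have i: "\<theta> (a \<cdot> sinv a) \<in> idems S" using idem mult_sinv_idem a by blast
    show "\<theta> (a \<cdot> sinv a) \<preceq> \<theta> a \<cdot> sinv (\<theta> a)" using le[of a "sinv a"] c inv by simp
    have "\<theta> a \<preceq> \<theta> (a \<cdot> sinv a) \<cdot> \<theta> a"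
      using le[of "a \<cdot> sinv a" a] c by (simp add: mult_closed sinv_props)
    then have "\<theta> a \<cdot> sinv (\<theta> a) \<preceq> \<theta> (a \<cdot> sinv a) \<cdot> \<theta> a \<cdot> sinv (\<theta> a)"
      using nat_le_mult nat_le_refl c i by (simp add: mult_closed idems_closed)
    also have "\<theta> (a \<cdot> sinv a) \<cdot> \<theta> a \<cdot> sinv (\<theta> a) = \<theta> (a \<cdot> sinv a) \<cdot> (\<theta> a \<cdot> sinv (\<theta> a))"
      using c i by (simp add: mult_assoc idems_closed)
    finally show "\<theta> a \<cdot> sinv (\<theta> a) \<preceq> \<theta> (a \<cdot> sinv a)"
      using nat_le_trans nat_leI[OF mult_sinv_idem] c i by (meson idems_closed)
  qed (use a in \<open>simp_all add: cl mult_closed sinv_closed\<close>)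
  have tgt: "\<theta> (sinv a \<cdot> a) = sinv (\<theta> a) \<cdot> \<theta> a" if a: "a \<in> carrier S" for a
    using src[of "sinv a"] a by (simp add: inv sinv_closed sinv_sinv cl)
  show "ordered_functor (vec_ogpd S) (vec_ogpd S) \<theta>"
  proof (rule ordered_functorI, unfold vec_sel)
    fix a b assume a: "a \<in> carrier S" and b: "b \<in> carrier S"
    {
      assume ab: "sinv a \<cdot> a = b \<cdot> sinv b"
      \<comment> \<open>Both sides have the domain of \<open>\<theta> a\<close>, and comparable
        elements with equal domains coincide, so the premorphism inequality is an equality
        here.\<close>
      have "\<theta> (a \<cdot> b) \<cdot> sinv (\<theta> (a \<cdot> b)) = \<theta> (a \<cdot> sinv a)"
        using src[of "a \<cdot> b"] a b ab by (simp add: composable_simps mult_closed)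
      moreover have "\<theta> a \<cdot> \<theta> b \<cdot> sinv (\<theta> a \<cdot> \<theta> b) = \<theta> a \<cdot> sinv (\<theta> a)"
        using tgt[OF a] src[OF b] ab by (intro composable_simps) (simp_all add: a b cl)
      ultimately show "\<theta> (a \<cdot> b) = \<theta> a \<cdot> \<theta> b"
        using src[OF a] le a b by - (rule nat_le_eq_domain, simp_all add: cl mult_closed)
    }
    assume "a \<preceq> b"
    then obtain e where e: "e \<in> idems S" "a = b \<cdot> e" unfolding nat_le_def by blast
    \<comment> \<open>The chain is \<open>\<theta> (b \<cdot> e) \<preceq> \<theta> b \<cdot>
      \<theta> e \<preceq> \<theta> b\<close>, where the second step holds because
      \<open>\<theta> e\<close> is idempotent.\<close>
    then show "\<theta> a \<preceq> \<theta> b"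
      using nat_le_trans[OF le nat_leI[OF idem]] b by (simp add: cl idems_closed)
  qed (simp_all add: cl src tgt)
qed

end

section \<open>The exponential of ordered groupoids\<close>

locale ordered_groupoid_pair = A: ordered_groupoid A + B: ordered_groupoid B
  for A :: "'a ogpd" and B :: "'b ogpd"
begin

lemma OGPD_sel:
  "src (OGPD A B) (f, \<tau>) = (f, restrict f (obj A))"
  "tgt (OGPD A B) (f, \<tau>) = (nt_target A B f \<tau>, restrict (nt_target A B f \<tau>) (obj A))"
  "cmp (OGPD A B) (f, \<tau>) (g, \<sigma>) = (f, \<lambda>x\<in>obj A. cmp B (\<tau> x) (\<sigma> x))"
  "ole (OGPD A B) (f, \<tau>) (g, \<sigma>) \<longleftrightarrow>
    (\<forall>a\<in>arr A. ole B (f a) (g a)) \<and> (\<forall>x\<in>obj A. ole B (\<tau> x) (\<sigma> x))"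
  by (simp_all add: OGPD_def)

lemma OGPD_arrI:
  assumes "f \<in> extensional (arr A)" "ordered_functor A B f"
    and "\<tau> \<in> extensional (obj A)"
    and "\<And>x. x \<in> obj A \<Longrightarrow> \<tau> x \<in> arr B"
    and "\<And>x y. x \<in> obj A \<Longrightarrow> y \<in> obj A \<Longrightarrow> ole A x y \<Longrightarrow> ole B (\<tau> x) (\<tau> y)"
    and "\<And>x. x \<in> obj A \<Longrightarrow> src B (\<tau> x) = f x"
  shows "(f, \<tau>) \<in> arr (OGPD A B)"
  using assms by (auto simp: OGPD_def PiE_def)

lemma OGPD_arrD:
  assumes "(f, \<tau>) \<in> arr (OGPD A B)"
  shows "f \<in> extensional (arr A)" "ordered_functor A B f"
    and "\<tau> \<in> extensional (obj A)"
    and "\<And>x. x \<in> obj A \<Longrightarrow> \<tau> x \<in> arr B"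
    and "\<And>x y. x \<in> obj A \<Longrightarrow> y \<in> obj A \<Longrightarrow> ole A x y \<Longrightarrow> ole B (\<tau> x) (\<tau> y)"
    and "\<And>x. x \<in> obj A \<Longrightarrow> src B (\<tau> x) = f x"
  using assms by (auto simp: OGPD_def PiE_def)

text \<open>The first two equations are oriented against \<open>ordered_functorD\<close>: sources
  and targets move inside the functor, where composability can be compared in
  \<open>A\<close>.\<close>

lemma functor_obj:
  assumes "ordered_functor A B f"
  shows "a \<in> arr A \<Longrightarrow> src B (f a) = f (src A a)" "a \<in> arr A \<Longrightarrow> tgt B (f a) = f (tgt A a)"
    "x \<in> obj A \<Longrightarrow> f x \<in> obj B" "x \<in> obj A \<Longrightarrow> src B (f x) = f x" "x \<in> obj A \<Longrightarrow> tgt B (f x) = f x"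
proof -
  note F = ordered_functorD[OF assms]
  show "a \<in> arr A \<Longrightarrow> src B (f a) = f (src A a)" "a \<in> arr A \<Longrightarrow> tgt B (f a) = f (tgt A a)"
    by (simp_all only: F(2,3))
  assume x: "x \<in> obj A"
  show "src B (f x) = f x" "tgt B (f x) = f x"
    using F(2,3)[OF A.objD(1)[OF x]] A.objD(2,3)[OF x] by simp_all
  then show "f x \<in> obj B"
    using F(1)[OF A.objD(1)[OF x]] by (simp add: obj_def)
qed

section \<open>The target functor of a transformation\<close>

context
  fixes f \<tau>
  assumes f\<tau>: "(f, \<tau>) \<in> arr (OGPD A B)"
begin

private lemmas D = OGPD_arrD[OF f\<tau>]
private lemmas F = ordered_functorD(1)[OF D(2)] functor_obj[OF D(2)] ordered_functorD(4,5)[OF D(2)]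

text \<open>Cancelling \<open>\<tau> (src A a)\<close> turns the conjugate into the naturality
  square of the fourth claim, the form in which it can be pasted.\<close>

lemma nt_target_props:
  assumes a: "a \<in> arr A"
  shows "nt_target A B f \<tau> a \<in> arr B"
    and "src B (nt_target A B f \<tau> a) = tgt B (\<tau> (src A a))"
    and "tgt B (nt_target A B f \<tau> a) = tgt B (\<tau> (tgt A a))"
    and "cmp B (\<tau> (src A a)) (nt_target A B f \<tau> a) = cmp B (f a) (\<tau> (tgt A a))"
  using a by (simp_all add: nt_target_def A.groupoid_simps B.groupoid_simps D(4,6) F B.cmp_assoc
      B.cmp_ginv_cancel)

text \<open>The last hypothesis is the naturality square of \<open>\<tau>\<close> at \<open>a\<close>, so naturality determines the
  target functor.\<close>

lemma nt_target_eqI: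
  assumes a: "a \<in> arr A" and b: "b \<in> arr B" "src B b = tgt B (\<tau> (src A a))"
    and eq: "cmp B (\<tau> (src A a)) b = cmp B (f a) (\<tau> (tgt A a))"
  shows "nt_target A B f \<tau> a = b"
  using B.cmp_ginv_cancel(1)[of "\<tau> (src A a)" b] B.cmp_ginv_cancel(1)[of "\<tau> (src A a)"
      "nt_target A B f \<tau> a"] nt_target_props[OF a] a b eq
  by (simp add: D(4) A.groupoid_simps)

text \<open>The square at an identity has \<open>\<tau> x\<close> on both sides. This makes
  components composable at each object whenever the target functor of one pair is the first
  component of the next.\<close>

lemma nt_target_obj: "x \<in> obj A \<Longrightarrow> nt_target A B f \<tau> x = tgt B (\<tau> x)"
  using B.cmp_src[of "\<tau> x"]
  by (intro nt_target_eqI) (simp_all add: A.groupoid_simps B.groupoid_simps D(4,6))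

text \<open>Pasting the squares at \<open>a\<close> and \<open>b\<close> gives a square for the
  composite, and the characterization by naturality yields functoriality. Monotonicity is read off
  the conjugation formula by OG1 and OG2.\<close>

lemma nt_target_functor: "ordered_functor A B (nt_target A B f \<tau>)"
proof (rule ordered_functorI)
  fix a b assume a: "a \<in> arr A" and b: "b \<in> arr A"
  note pa = nt_target_props[OF a] and pb = nt_target_props[OF b]
  note c = a b A.src_obj[OF a] A.tgt_obj[OF a] A.src_obj[OF b] A.tgt_obj[OF b]
  {
    assume ab: "tgt A a = src A b"
    let ?k = "cmp B (nt_target A B f \<tau> a) (nt_target A B f \<tau> b)"
    have "cmp B (\<tau> (src A a)) ?k = cmp B (cmp B (f a) (\<tau> (tgt A a))) (nt_target A B f \<tau> b)"
      using pa pb c ab by (simp add: B.cmp_assoc[symmetric] D(4))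
    also have "\<dots> = cmp B (f a) (cmp B (f b) (\<tau> (tgt A b)))"
      using pa pb c ab by (simp add: B.cmp_assoc D(4,6) F)
    also have "\<dots> = cmp B (f (cmp A a b)) (\<tau> (tgt A b))"
      using c ab by (simp add: B.cmp_assoc D(4,6) F)
    finally show "nt_target A B f \<tau> (cmp A a b) = ?k"
      using pa pb c ab by (intro nt_target_eqI) (simp_all add: A.groupoid_simps B.groupoid_simps)
  }
  assume le: "ole A a b"
  have 1: "ole B (\<tau> (src A a)) (\<tau> (src A b))" "ole B (\<tau> (tgt A a)) (\<tau> (tgt A b))"
    using D(5) c A.ole_src[OF le] A.ole_tgt[OF le] by blast+
  show "ole B (nt_target A B f \<tau> a) (nt_target A B f \<tau> b)"
    unfolding nt_target_def using c le 1
    by (simp add: B.OG2 B.OG1 F D(4,6) B.groupoid_simps)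
qed (simp_all add: nt_target_props nt_target_obj A.groupoid_simps B.groupoid_simps D(4))

lemma OGPD_src_closed: "(f, restrict f (obj A)) \<in> arr (OGPD A B)"
  by (rule OGPD_arrI) (simp_all add: D F A.groupoid_simps)

lemma nt_target_ext: "nt_target A B f \<tau> \<in> extensional (arr A)"
  by (simp add: nt_target_def)

lemma nt_target_identity: "nt_target A B f (restrict f (obj A)) = f"
proof (rule extensionalityI[of _ "arr A"])
  fix a assume a: "a \<in> arr A"
  have "cmp B (ginv B (src B (f a))) (src B (f a)) = src B (f a)"
    using a by (simp add: B.groupoid_simps F(1))
  then show "nt_target A B f (restrict f (obj A)) a = f a"
    using a B.cmp_ginv_cancel(1)[of "src B (f a)" "f a"] B.cmp_src[of "f a"] B.cmp_tgt[of "f a"]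
    by (simp add: nt_target_def A.groupoid_simps B.groupoid_simps F(1-3))
qed (simp_all add: nt_target_def D(1))

lemma OGPD_ginv_closed: "(nt_target A B f \<tau>, \<lambda>x\<in>obj A. ginv B (\<tau> x)) \<in> arr (OGPD A B)"
  by (rule OGPD_arrI)
    (simp_all add: nt_target_functor nt_target_ext nt_target_obj D(4,5) B.OG1 B.groupoid_simps)

lemma OGPD_tgt_closed:
  "(nt_target A B f \<tau>, restrict (nt_target A B f \<tau>) (obj A)) \<in> arr (OGPD A B)"
  by (rule OGPD_arrI)
    (simp_all add: nt_target_functor nt_target_ext ordered_functorD(1,5)[OF nt_target_functor]
      functor_obj[OF nt_target_functor] A.groupoid_simps)

text \<open>Composing the square with the inverses of the two components reverses it; the result is
  the square of the inverse transformation, whose target is therefore \<open>f\<close>.\<close>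

lemma nt_target_ginv: "nt_target A B (nt_target A B f \<tau>) (\<lambda>x\<in>obj A. ginv B (\<tau> x)) = f"
proof (rule extensionalityI[of _ "arr A"])
  fix a assume a: "a \<in> arr A"
  note p = nt_target_props[OF a]
  have "cmp B (\<tau> (src A a)) (cmp B (nt_target A B f \<tau> a) (ginv B (\<tau> (tgt A a)))) =
      cmp B (cmp B (f a) (\<tau> (tgt A a))) (ginv B (\<tau> (tgt A a)))"
    using a p by (simp add: B.cmp_assoc[symmetric] D(4) A.groupoid_simps B.groupoid_simps)
  also have "\<dots> = f a"
    using a B.cmp_tgt[of "f a"]
    by (simp add: B.cmp_assoc D(4,6) F A.groupoid_simps B.groupoid_simps)
  finally have "cmp B (ginv B (\<tau> (src A a))) (f a) =
      cmp B (nt_target A B f \<tau> a) (ginv B (\<tau> (tgt A a)))"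
    using a p B.cmp_ginv_cancel(1)[of "\<tau> (src A a)"
        "cmp B (nt_target A B f \<tau> a) (ginv B (\<tau> (tgt A a)))"]
    by (simp add: D(4) A.groupoid_simps B.groupoid_simps)
  \<comment> \<open>The characterization is applied to the inverse pair rather than to the pair
    fixed in this context, hence its global form.\<close>
  then show "nt_target A B (nt_target A B f \<tau>) (\<lambda>x\<in>obj A. ginv B (\<tau> x)) a = f a"
    using a p by (intro ordered_groupoid_pair.nt_target_eqI[OF _ OGPD_ginv_closed])
     (simp_all add: ordered_groupoid_pair_axioms D(4,6) F A.groupoid_simps B.groupoid_simps)
qed (simp_all add: nt_target_def D(1))

end

section \<open>Composition of transformations\<close>

context
  fixes f \<tau> g \<sigma>
  assumes f\<tau>: "(f, \<tau>) \<in> arr (OGPD A B)" and g\<sigma>: "(g, \<sigma>) \<in> arr (OGPD A B)"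
    and g: "g = nt_target A B f \<tau>"
begin

private lemmas E1 = OGPD_arrD[OF f\<tau>] and E2 = OGPD_arrD[OF g\<sigma>]
private lemmas F1 = ordered_functorD(1)[OF E1(2)] functor_obj[OF E1(2)]
  ordered_functorD(4)[OF E1(2)]
private lemmas go = nt_target_obj[OF f\<tau>, folded g]

lemma OGPD_cmp_closed: "(f, \<lambda>x\<in>obj A. cmp B (\<tau> x) (\<sigma> x)) \<in> arr (OGPD A B)"
  by (rule OGPD_arrI) (simp_all add: E1 E2 go B.groupoid_simps B.OG2)

text \<open>The squares of \<open>\<tau>\<close> and \<open>\<sigma>\<close> at \<open>a\<close> are
  pasted along \<open>g a\<close>, the target side of the first and the source side of the
  second.\<close>

lemma nt_target_cmp: "nt_target A B f (\<lambda>x\<in>obj A. cmp B (\<tau> x) (\<sigma> x)) = nt_target A B g \<sigma>"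
proof (rule extensionalityI[of _ "arr A"])
  fix a assume a: "a \<in> arr A"
  note c = a A.src_obj[OF a] A.tgt_obj[OF a]
  note p = nt_target_props[OF f\<tau> a, folded g] and q = nt_target_props[OF g\<sigma> a]
  have "cmp B (cmp B (\<tau> (src A a)) (\<sigma> (src A a))) (nt_target A B g \<sigma> a) =
      cmp B (\<tau> (src A a)) (cmp B (g a) (\<sigma> (tgt A a)))"
    using c p q by (simp add: B.cmp_assoc E1(4) E2(4,6) go)
  also have "\<dots> = cmp B (cmp B (f a) (\<tau> (tgt A a))) (\<sigma> (tgt A a))"
    using c p q by (simp add: B.cmp_assoc[symmetric] E1(4) E2(4,6) go)
  also have "\<dots> = cmp B (f a) (cmp B (\<tau> (tgt A a)) (\<sigma> (tgt A a)))"
    using c by (simp add: B.cmp_assoc E1(4,6) E2(4,6) F1 go)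
  finally show "nt_target A B f (\<lambda>x\<in>obj A. cmp B (\<tau> x) (\<sigma> x)) a = nt_target A B g \<sigma> a"
    using c q by (intro nt_target_eqI[OF OGPD_cmp_closed])
      (simp_all add: E1(4) E2(4,6) go B.groupoid_simps)
qed (simp_all add: nt_target_def)

end

lemma OGPD_is_ginv:
  assumes "(f, \<tau>) \<in> arr (OGPD A B)"
  shows "is_ginv (OGPD A B) (f, \<tau>) (nt_target A B f \<tau>, \<lambda>x\<in>obj A. ginv B (\<tau> x))"
  unfolding is_ginv_def OGPD_sel using OGPD_arrD[OF assms]
  by (simp add: OGPD_ginv_closed nt_target_ginv nt_target_obj assms B.groupoid_simps
      cong: restrict_cong)

lemma OGPD_groupoid: "groupoid (OGPD A B)"
proof (unfold_locales, goal_cases)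
  case (1 g) then show ?case by (cases g) (simp add: OGPD_sel OGPD_src_closed)
next
  case (2 g) then show ?case by (cases g) (simp add: OGPD_sel OGPD_tgt_closed)
next
  case (3 g) then show ?case by (cases g) (simp add: OGPD_sel)
next
  case (4 g) then show ?case by (cases g) (simp add: OGPD_sel nt_target_identity)
next
  case (5 g) then show ?case by (cases g) (simp add: OGPD_sel)
next
  case (6 g) then show ?case
    by (cases g) (simp add: OGPD_sel nt_target_identity[OF OGPD_tgt_closed])
next
  case (7 g h) then show ?case
    by (cases g; cases h) (simp add: OGPD_sel OGPD_cmp_closed)
next
  case (8 g h) then show ?case
    by (cases g; cases h) (simp add: OGPD_sel)
next
  case (9 g h) then show ?case
    by (cases g; cases h) (simp add: OGPD_sel nt_target_cmp)
next
  case (10 g h k)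
  obtain f \<tau> f' \<tau>' f'' \<tau>'' where e: "g = (f, \<tau>)" "h = (f', \<tau>')" "k = (f'', \<tau>'')"
    by (metis surj_pair)
  note h = 10[unfolded e OGPD_sel prod.inject]
  show ?case
    unfolding e OGPD_sel
    using OGPD_arrD(4,6)[OF h(1)] OGPD_arrD(4,6)[OF h(2)] OGPD_arrD(4,6)[OF h(3)]
      nt_target_obj[OF h(1)] nt_target_obj[OF h(2)] h(4,5)
    by (auto intro!: restrict_ext B.cmp_assoc)
next
  case (11 g) then show ?case
  proof (cases g)
    case (Pair f \<tau>)
    note D = OGPD_arrD[OF 11[unfolded Pair]]
    show ?thesis unfolding Pair OGPD_sel
      by (auto intro!: extensionalityI[of _ "obj A"] simp: D(3,4) D(6)[symmetric] B.cmp_src)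
  qed
next
  case (12 g) then show ?case
  proof (cases g)
    case (Pair f \<tau>)
    note D = OGPD_arrD[OF 12[unfolded Pair]]
    show ?thesis unfolding Pair OGPD_sel
      by (auto intro!: extensionalityI[of _ "obj A"]
          simp: D(3,4) nt_target_obj[OF 12[unfolded Pair]] B.cmp_tgt)
  qed
next
  case (13 g) then show ?case using OGPD_is_ginv by (cases g) blast
qed

lemma OGPD_ginv:
  "(f, \<tau>) \<in> arr (OGPD A B) \<Longrightarrow>
    ginv (OGPD A B) (f, \<tau>) = (nt_target A B f \<tau>, \<lambda>x\<in>obj A. ginv B (\<tau> x))"
  using groupoid.ginv_eqI[OF OGPD_groupoid] OGPD_is_ginv by blast

section \<open>The pointwise order on the exponential\<close>

lemma OGPD_partial_order:
  "partial_order_on (arr (OGPD A B))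
    {(g, h). g \<in> arr (OGPD A B) \<and> h \<in> arr (OGPD A B) \<and> ole (OGPD A B) g h}"
proof -
  let ?G = "OGPD A B"
  have refl: "ole ?G g g" if "g \<in> arr ?G" for g
    using that OGPD_arrD[of "fst g" "snd g"]
    by (cases g) (simp add: OGPD_sel B.ole_refl ordered_functorD(1))
  have trans: "ole ?G g k" if "ole ?G g h" "ole ?G h k" "g \<in> arr ?G" "h \<in> arr ?G" "k \<in> arr ?G"
    for g h k
  proof -
    obtain f \<tau> f' \<tau>' f'' \<tau>'' where e: "g = (f, \<tau>)" "h = (f', \<tau>')" "k = (f'', \<tau>'')"
      by (metis surj_pair)
    note D = OGPD_arrD(2,4)[OF that(3)[unfolded e]] OGPD_arrD(2,4)[OF that(4)[unfolded e]]
      OGPD_arrD(2,4)[OF that(5)[unfolded e]]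
    show ?thesis
      using that(1,2) unfolding e OGPD_sel
      by (blast intro: B.ole_trans ordered_functorD(1) D)
  qed
  \<comment> \<open>The order sees only values on \<open>arr A\<close> and \<open>obj A\<close>;
    extensionality of both components makes pairs with equal values there equal.\<close>
  have antisym: "g = h" if "ole ?G g h" "ole ?G h g" "g \<in> arr ?G" "h \<in> arr ?G" for g h
  proof -
    obtain f \<tau> f' \<tau>' where e: "g = (f, \<tau>)" "h = (f', \<tau>')" by (metis surj_pair)
    note D = OGPD_arrD[OF that(3)[unfolded e]] and D' = OGPD_arrD[OF that(4)[unfolded e]]
    show ?thesis
      using that(1,2) unfolding e OGPD_sel prod.inject
      by (intro conjI extensionalityI[of f "arr A"] extensionalityI[of \<tau> "obj A"])
        (simp_all add: D(1,3,4) D'(1,3,4) ordered_functorD(1)[OF D(2)]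
          ordered_functorD(1)[OF D'(2)] B.ole_antisym)
  qed
  show ?thesis
    unfolding partial_order_on_def preorder_on_def refl_on_def antisym_def trans_def
    using refl trans antisym by blast
qed

text \<open>Inversion in the exponential replaces a functor by the target functor, so OG1 there
  requires the target to depend monotonically on the pair.\<close>

lemma nt_target_mono:
  assumes "(f, \<tau>) \<in> arr (OGPD A B)" "(g, \<sigma>) \<in> arr (OGPD A B)"
    and "ole (OGPD A B) (f, \<tau>) (g, \<sigma>)" "a \<in> arr A"
  shows "ole B (nt_target A B f \<tau> a) (nt_target A B g \<sigma> a)"
proof -
  note D = OGPD_arrD[OF assms(1)] and D' = OGPD_arrD[OF assms(2)]
  note F = ordered_functorD(1)[OF D(2)] functor_obj[OF D(2)]
    and F' = ordered_functorD(1)[OF D'(2)] functor_obj[OF D'(2)]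
  show ?thesis
    using assms(3,4) A.src_obj[of a] A.tgt_obj[of a]
    by (simp add: nt_target_def OGPD_sel B.OG2 B.OG1 F F' D(4,6) D'(4,6) B.groupoid_simps)
qed

text \<open>Over a subfunctor \<open>h\<close> of \<open>f\<close>, a transformation \<open>\<tau>\<close> restricts pointwise to
  \<open>x \<mapsto> (xh | x\<tau>)\<close>.\<close>

lemma OGPD_restriction:
  assumes h: "(h, \<rho>) \<in> obj (OGPD A B)" and f\<tau>: "(f, \<tau>) \<in> arr (OGPD A B)"
    and le: "ole (OGPD A B) (h, \<rho>) (src (OGPD A B) (f, \<tau>))"
  shows "\<exists>!k. k \<in> arr (OGPD A B) \<and> src (OGPD A B) k = (h, \<rho>) \<and> ole (OGPD A B) k (f, \<tau>)"
proof -
  \<comment> \<open>An identity of the exponential has \<open>restrict h (obj A)\<close> as its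
    second component, so \<open>le\<close> amounts to \<open>h\<close> lying pointwise below
    \<open>f\<close>.\<close>
  have h': "(h, \<rho>) \<in> arr (OGPD A B)" and \<rho>: "restrict h (obj A) = \<rho>"
    using h unfolding obj_def[of "OGPD A B"] by (auto simp: OGPD_sel)
  note D = OGPD_arrD[OF f\<tau>] and E = OGPD_arrD[OF h']
  have le1: "ole B (h a) (f a)" if "a \<in> arr A" for a
    using le that by (simp add: OGPD_sel)
  have x: "h x \<in> obj B" "\<tau> x \<in> arr B" "ole B (h x) (src B (\<tau> x))" if "x \<in> obj A" for x
    using that functor_obj(3)[OF E(2)] D(4,6) le1 by (simp_all add: A.objD)
  define \<kappa> where "\<kappa> = (\<lambda>x\<in>obj A. B.restriction (h x) (\<tau> x))"
  have \<kappa>: "\<kappa> x \<in> arr B" "src B (\<kappa> x) = h x" "ole B (\<kappa> x) (\<tau> x)" if "x \<in> obj A" for x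
    using that B.restriction_props[OF x[OF that]] by (simp_all add: \<kappa>_def)
  have "(h, \<kappa>) \<in> arr (OGPD A B)"
  proof (rule OGPD_arrI)
    fix x y assume xy: "x \<in> obj A" "y \<in> obj A" "ole A x y"
    then have "ole B (h x) (h y)" using ordered_functorD(5)[OF E(2)] by (simp add: A.objD)
    then show "ole B (\<kappa> x) (\<kappa> y)"
      using xy B.restriction_mono[OF x[OF xy(1)] x[OF xy(2)]] D(5) by (simp add: \<kappa>_def)
  qed (simp_all add: E \<kappa>, simp add: \<kappa>_def)
  moreover have "ole (OGPD A B) (h, \<kappa>) (f, \<tau>)"
    by (simp add: OGPD_sel \<kappa> le1)
  moreover have "k = (h, \<kappa>)"
    if "k \<in> arr (OGPD A B)" "src (OGPD A B) k = (h, \<rho>)" "ole (OGPD A B) k (f, \<tau>)" for k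
  proof (cases k)
    case (Pair h' \<kappa>')
    then have [simp]: "h' = h" using that(2) by (simp add: OGPD_sel)
    note K = OGPD_arrD[OF that(1)[unfolded Pair]]
    have "\<kappa>' = \<kappa>"
    proof (rule extensionalityI[of _ "obj A"])
      fix x assume x: "x \<in> obj A"
      then have "ole B (\<kappa>' x) (\<tau> x)" using that(3) by (simp add: Pair OGPD_sel)
      then show "\<kappa>' x = \<kappa> x"
        using B.ole_eq_src[of "\<kappa>' x" "\<tau> x" "\<kappa> x"] x \<kappa> K(4,6) D(4) by simp
    qed (simp_all add: K(3), simp add: \<kappa>_def)
    then show ?thesis by (simp add: Pair)
  qed
  ultimately show ?thesis using \<rho> by (metis OGPD_sel(1))
qed

theorem OGPD_ordered_groupoid: "ordered_groupoid (OGPD A B)"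
proof -
  interpret G: groupoid "OGPD A B" by (rule OGPD_groupoid)
  show ?thesis
  proof (unfold_locales, goal_cases)
    case 1 show ?case by (rule OGPD_partial_order)
  next
    case (2 g h) then show ?case
      using OGPD_arrD(4)[of "fst g" "snd g"] OGPD_arrD(4)[of "fst h" "snd h"]
      by (cases g; cases h)
        (simp add: OGPD_ginv, simp add: OGPD_sel nt_target_mono B.OG1)
  next
    case (3 g1 g2 h1 h2)
    obtain f1 \<tau>1 f2 \<tau>2 k1 \<sigma>1 k2 \<sigma>2
      where e: "g1 = (f1, \<tau>1)" "g2 = (f2, \<tau>2)" "h1 = (k1, \<sigma>1)" "h2 = (k2, \<sigma>2)"
      by (metis surj_pair)
    note h = 3[unfolded e OGPD_sel prod.inject]
    show ?case
      unfolding e OGPD_sel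
      using h(5-8) OGPD_arrD(4,6)[OF h(1)] OGPD_arrD(4,6)[OF h(2)] OGPD_arrD(4,6)[OF h(3)]
        OGPD_arrD(4,6)[OF h(4)] nt_target_obj[OF h(1)] nt_target_obj[OF h(2)]
      by (simp add: B.OG2)
  next
    case (4 x g) then show ?case by (cases x; cases g) (simp add: OGPD_restriction)
  qed
qed

end

section \<open>The monoid structure\<close>

text \<open>At \<open>vec_ogpd S\<close> this is the action of the holomorph on \<open>S\<close>.
  For arrows of the exponential, the other path around the square, \<open>\<tau> (src A a)\<close>
  followed by the target functor at \<open>a\<close>, has the same value.\<close>

definition OGPD_act :: "'a ogpd \<Rightarrow> 'a \<Rightarrow> ('a \<Rightarrow> 'a) \<times> ('a \<Rightarrow> 'a) \<Rightarrow> 'a"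
  where "OGPD_act A a = (\<lambda>(f, \<tau>). cmp A (f a) (\<tau> (tgt A a)))"

context ordered_groupoid
begin

sublocale pair: ordered_groupoid_pair G G ..

abbreviation E where "E \<equiv> OGPD G G"
abbreviation M where "M \<equiv> OGPD_monoid G"

lemma monoid_sel:
  "carrier M = arr E" "\<one>\<^bsub>M\<^esub> = (\<lambda>a\<in>arr G. a, \<lambda>x\<in>obj G. x)"
  "(f, \<tau>) \<otimes>\<^bsub>M\<^esub> (g, \<sigma>) =
    (compose (arr G) g f, \<lambda>x\<in>obj G. cmp G (g (\<tau> x)) (\<sigma> (tgt G (\<tau> x))))"
  by (simp_all add: OGPD_monoid_def)

lemma one_closed: "\<one>\<^bsub>M\<^esub> \<in> arr E"
  unfolding monoid_sel
  by (intro pair.OGPD_arrI ordered_functorI) (simp_all add: groupoid_simps)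

context
  fixes f \<tau> g \<sigma>
  assumes f\<tau>: "(f, \<tau>) \<in> arr E" and g\<sigma>: "(g, \<sigma>) \<in> arr E"
begin

private lemmas D1 = pair.OGPD_arrD[OF f\<tau>] and D2 = pair.OGPD_arrD[OF g\<sigma>]
private lemmas F1 = ordered_functorD(1)[OF D1(2)] pair.functor_obj[OF D1(2)]
  ordered_functorD(4,5)[OF D1(2)]
private lemmas F2 = ordered_functorD(1)[OF D2(2)] pair.functor_obj[OF D2(2)]
  ordered_functorD(4,5)[OF D2(2)]

text \<open>The second component is composable because \<open>\<sigma>\<close> is evaluated at the
  end of \<open>\<tau> x\<close>, where its source is \<open>g (tgt G (\<tau> x))\<close>, the end
  of \<open>g (\<tau> x)\<close>.\<close>

lemma mult_closed: "(f, \<tau>) \<otimes>\<^bsub>M\<^esub> (g, \<sigma>) \<in> arr E"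
  unfolding monoid_sel
proof (rule pair.OGPD_arrI)
  show "ordered_functor G G (compose (arr G) g f)"
    by (rule ordered_functorI) (simp_all add: compose_eq F1 F2 groupoid_simps)
  fix x y assume xy: "x \<in> obj G" "y \<in> obj G" "ole G x y"
  then show "ole G ((\<lambda>x\<in>obj G. cmp G (g (\<tau> x)) (\<sigma> (tgt G (\<tau> x)))) x)
      ((\<lambda>x\<in>obj G. cmp G (g (\<tau> x)) (\<sigma> (tgt G (\<tau> x)))) y)"
    using D1(5)[OF xy] by (simp add: OG2 F2 D1(4) D2(4-6) ole_tgt groupoid_simps)
qed (simp_all add: F1 F2 D1(4,6) D2(4,6) groupoid_simps compose_eq)

text \<open>The product is horizontal composition: the image under \<open>g\<close> of the square of
  \<open>\<tau>\<close> at \<open>a\<close>, pasted to the square of \<open>\<sigma>\<close> at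
  \<open>nt_target G G f \<tau> a\<close>, is the square of the product.\<close>

lemma nt_target_mult:
  "nt_target G G (compose (arr G) g f) (\<lambda>x\<in>obj G. cmp G (g (\<tau> x)) (\<sigma> (tgt G (\<tau> x)))) =
    compose (arr G) (nt_target G G g \<sigma>) (nt_target G G f \<tau>)"
proof (rule extensionalityI[of _ "arr G"])
  fix a assume a: "a \<in> arr G"
  note c = a src_obj[OF a] tgt_obj[OF a]
  let ?f' = "nt_target G G f \<tau>" and ?g' = "nt_target G G g \<sigma>"
  let ?s = "src G a" and ?t = "tgt G a"
  note p = pair.nt_target_props[OF f\<tau> a]
  note q = pair.nt_target_props[OF g\<sigma> p(1)]
  have "cmp G (cmp G (g (\<tau> ?s)) (\<sigma> (tgt G (\<tau> ?s)))) (?g' (?f' a)) =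
      cmp G (g (\<tau> ?s)) (cmp G (\<sigma> (src G (?f' a))) (?g' (?f' a)))"
    using c p q by (simp add: cmp_assoc D1(4) D2(4,6) F2 groupoid_simps)
  also have "\<dots> = cmp G (g (\<tau> ?s)) (cmp G (g (?f' a)) (\<sigma> (tgt G (?f' a))))"
    by (simp only: q(4))
  also have "\<dots> = cmp G (g (cmp G (\<tau> ?s) (?f' a))) (\<sigma> (tgt G (\<tau> ?t)))"
    using c p(1-3) by (simp add: cmp_assoc D1(4) D2(4,6) F2 groupoid_simps)
  also have "\<dots> = cmp G (g (f a)) (cmp G (g (\<tau> ?t)) (\<sigma> (tgt G (\<tau> ?t))))"
    unfolding p(4) using c by (simp add: cmp_assoc D1(4,6) D2(4,6) F1 F2 groupoid_simps)
  finally show "nt_target G G (compose (arr G) g f)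
      (\<lambda>x\<in>obj G. cmp G (g (\<tau> x)) (\<sigma> (tgt G (\<tau> x)))) a = compose (arr G) ?g' ?f' a"
    using c p(1-3) q(1-3)
    by (intro pair.nt_target_eqI[OF mult_closed[unfolded monoid_sel]])
      (simp_all add: compose_eq D1(4) D2(4,6) F2 groupoid_simps)
qed (simp_all add: nt_target_def)

text \<open>The diagonal for \<open>(f, \<tau>)\<close> ends where \<open>\<tau> (tgt G a)\<close>
  does, so both sides evaluate \<open>\<sigma>\<close> at the same object; functoriality of
  \<open>g\<close> splits the remaining factor.\<close>

lemma act_mult:
  assumes a: "a \<in> arr G"
  shows "OGPD_act G a ((f, \<tau>) \<otimes>\<^bsub>M\<^esub> (g, \<sigma>)) = OGPD_act G (OGPD_act G a (f, \<tau>)) (g, \<sigma>)"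
  using a tgt_obj[OF a]
  by (simp add: OGPD_act_def monoid_sel compose_eq cmp_assoc D1(4,6) D2(4,6) F1 F2 groupoid_simps)

end

section \<open>The monoid laws\<close>

lemma one_mult:
  assumes "(g, \<sigma>) \<in> arr E"
  shows "\<one>\<^bsub>M\<^esub> \<otimes>\<^bsub>M\<^esub> (g, \<sigma>) = (g, \<sigma>)"
proof -
  note D = pair.OGPD_arrD[OF assms]
  have "cmp G (g x) (\<sigma> x) = \<sigma> x" if "x \<in> obj G" for x
    using that D(4,6)[OF that] cmp_src by metis
  then show ?thesis
    unfolding monoid_sel prod.inject
    by (intro conjI extensionalityI[OF _ D(1)] extensionalityI[OF _ D(3)])
      (simp_all add: compose_eq objD)
qed

lemma mult_one:
  assumes "(g, \<sigma>) \<in> arr E"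
  shows "(g, \<sigma>) \<otimes>\<^bsub>M\<^esub> \<one>\<^bsub>M\<^esub> = (g, \<sigma>)"
proof -
  note D = pair.OGPD_arrD[OF assms]
  show ?thesis
    unfolding monoid_sel prod.inject
    by (intro conjI extensionalityI[OF _ D(1)] extensionalityI[OF _ D(3)])
      (simp_all add: compose_eq D(4) ordered_functorD(1)[OF D(2)] groupoid_simps)
qed

text \<open>At \<open>x\<close> both sides are the composite of \<open>h (g (\<tau> x))\<close>,
  \<open>h (\<sigma> y)\<close> and \<open>\<rho> (tgt G (\<sigma> y))\<close> with
  \<open>y = tgt G (\<tau> x)\<close>; functoriality of \<open>h\<close> splits the left
  side.\<close>

lemma mult_assoc:
  assumes "(f, \<tau>) \<in> arr E" "(g, \<sigma>) \<in> arr E" "(h, \<rho>) \<in> arr E"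
  shows "((f, \<tau>) \<otimes>\<^bsub>M\<^esub> (g, \<sigma>)) \<otimes>\<^bsub>M\<^esub> (h, \<rho>) = (f, \<tau>) \<otimes>\<^bsub>M\<^esub> ((g, \<sigma>) \<otimes>\<^bsub>M\<^esub> (h, \<rho>))"
proof -
  note D1 = pair.OGPD_arrD[OF assms(1)] and D2 = pair.OGPD_arrD[OF assms(2)]
    and D3 = pair.OGPD_arrD[OF assms(3)]
  note F1 = ordered_functorD(1)[OF D1(2)]
  note F2 = ordered_functorD(1)[OF D2(2)] pair.functor_obj[OF D2(2)]
  note F3 = ordered_functorD(1)[OF D3(2)] pair.functor_obj[OF D3(2)]
    ordered_functorD(4)[OF D3(2)]
  show ?thesis
    unfolding monoid_sel prod.inject
    by (intro conjI extensionalityI[of _ "arr G"] extensionalityI[of _ "obj G"])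
      (simp_all add: compose_eq cmp_assoc D1(4,6) D2(4,6) D3(4,6) F1 F2 F3 groupoid_simps)
qed

lemma monoid_OGPD: "monoid M"
proof (rule monoidI)
  show "\<one>\<^bsub>M\<^esub> \<in> carrier M" by (simp add: monoid_sel(1) one_closed)
  fix x y z assume c: "x \<in> carrier M" "y \<in> carrier M" "z \<in> carrier M"
  show "x \<otimes>\<^bsub>M\<^esub> y \<in> carrier M"
    using c by (cases x; cases y) (simp only: monoid_sel(1) mult_closed)
  show "x \<otimes>\<^bsub>M\<^esub> y \<otimes>\<^bsub>M\<^esub> z = x \<otimes>\<^bsub>M\<^esub> (y \<otimes>\<^bsub>M\<^esub> z)"
    using c by (cases x; cases y; cases z) (simp only: monoid_sel(1) mult_assoc)
  show "\<one>\<^bsub>M\<^esub> \<otimes>\<^bsub>M\<^esub> x = x"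
    using c by (cases x) (simp only: monoid_sel(1) one_mult)
  show "x \<otimes>\<^bsub>M\<^esub> \<one>\<^bsub>M\<^esub> = x"
    using c by (cases x) (simp only: monoid_sel(1) mult_one)
qed

text \<open>Naturality of \<open>\<sigma>\<close> at \<open>x\<tau>'\<close> swaps the two middle factors.\<close>

lemma interchange:
  assumes "(f, \<tau>) \<in> arr E" "(f', \<tau>') \<in> arr E" "(g, \<sigma>) \<in> arr E" "(g', \<sigma>') \<in> arr E"
    and f': "f' = nt_target G G f \<tau>" and g': "g' = nt_target G G g \<sigma>"
  shows "cmp E (f, \<tau>) (f', \<tau>') \<otimes>\<^bsub>M\<^esub> cmp E (g, \<sigma>) (g', \<sigma>') =
    cmp E ((f, \<tau>) \<otimes>\<^bsub>M\<^esub> (g, \<sigma>)) ((f', \<tau>') \<otimes>\<^bsub>M\<^esub> (g', \<sigma>'))"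
proof -
  note D1 = pair.OGPD_arrD[OF assms(1)] and D2 = pair.OGPD_arrD[OF assms(2)]
    and D3 = pair.OGPD_arrD[OF assms(3)] and D4 = pair.OGPD_arrD[OF assms(4)]
  note fo = pair.nt_target_obj[OF assms(1), folded f']
    and go = pair.nt_target_obj[OF assms(3), folded g']
  note F3 = ordered_functorD(1)[OF D3(2)] pair.functor_obj[OF D3(2)]
    ordered_functorD(4)[OF D3(2)]
  note F4 = ordered_functorD(1)[OF D4(2)] pair.functor_obj[OF D4(2)]
  have "cmp G (g (cmp G (\<tau> x) (\<tau>' x))) (cmp G (\<sigma> (tgt G (\<tau>' x))) (\<sigma>' (tgt G (\<tau>' x)))) =
      cmp G (cmp G (g (\<tau> x)) (\<sigma> (tgt G (\<tau> x)))) (cmp G (g' (\<tau>' x)) (\<sigma>' (tgt G (\<tau>' x))))"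
    (is "?l = ?r") if x: "x \<in> obj G" for x
  proof -
    let ?t = "\<tau>' x"
    have t: "?t \<in> arr G" "src G ?t = tgt G (\<tau> x)" "\<tau> x \<in> arr G"
      using x D1(4) D2(4,6) fo by simp_all
    have "?l = cmp G (g (\<tau> x)) (cmp G (cmp G (g ?t) (\<sigma> (tgt G ?t))) (\<sigma>' (tgt G ?t)))"
      using t by (simp add: cmp_assoc D3(4,6) D4(4,6) F3 go groupoid_simps)
    also have "\<dots> = cmp G (g (\<tau> x)) (cmp G (cmp G (\<sigma> (src G ?t)) (g' ?t)) (\<sigma>' (tgt G ?t)))"
      using pair.nt_target_props(4)[OF assms(3) t(1)] g' by simp
    also have "\<dots> = ?r"
      using t by (simp add: cmp_assoc D3(4,6) D4(4,6) F3 F4 go groupoid_simps)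
    finally show ?thesis .
  qed
  then show ?thesis
    unfolding pair.OGPD_sel monoid_sel prod.inject
    by (intro conjI refl extensionalityI[of _ "obj G"])
      (simp_all add: D1(4) D2(4,6) fo groupoid_simps)
qed

lemma mult_mono:
  assumes "(f, \<tau>) \<in> arr E" "(f', \<tau>') \<in> arr E" "(g, \<sigma>) \<in> arr E" "(g', \<sigma>') \<in> arr E"
    and le: "ole E (f, \<tau>) (f', \<tau>')" "ole E (g, \<sigma>) (g', \<sigma>')"
  shows "ole E ((f, \<tau>) \<otimes>\<^bsub>M\<^esub> (g, \<sigma>)) ((f', \<tau>') \<otimes>\<^bsub>M\<^esub> (g', \<sigma>'))"
proof -
  note D1 = pair.OGPD_arrD[OF assms(1)] and D2 = pair.OGPD_arrD[OF assms(2)]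
    and D3 = pair.OGPD_arrD[OF assms(3)] and D4 = pair.OGPD_arrD[OF assms(4)]
  note F1 = ordered_functorD(1)[OF D1(2)] and F2 = ordered_functorD(1)[OF D2(2)]
  note F3 = ordered_functorD(1)[OF D3(2)] pair.functor_obj[OF D3(2)]
    and F4 = ordered_functorD(1)[OF D4(2)] pair.functor_obj[OF D4(2)]
  note l = le[unfolded pair.OGPD_sel]
  \<comment> \<open>Function and argument grow together, so the comparison passes through
    \<open>g b\<close>; the one for \<open>\<sigma>\<close> passes through
    \<open>\<sigma> y\<close>.\<close>
  have g: "ole G (g a) (g' b)" if "ole G a b" "a \<in> arr G" "b \<in> arr G" for a b
    using ole_trans[of "g a" "g b" "g' b"] ordered_functorD(5)[OF D3(2)] l(2) that F3(1) F4(1)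
    by blast
  have s: "ole G (\<sigma> x) (\<sigma>' y)" if "ole G x y" "x \<in> obj G" "y \<in> obj G" for x y
    using ole_trans[of "\<sigma> x" "\<sigma> y" "\<sigma>' y"] D3(4,5) D4(4) l(2) that by blast
  show ?thesis
    unfolding pair.OGPD_sel monoid_sel
  proof (intro conjI ballI)
    fix a assume "a \<in> arr G"
    then show "ole G (compose (arr G) g f a) (compose (arr G) g' f' a)"
      using g l(1) F1 F2 by (simp add: compose_eq)
  next
    fix x assume x: "x \<in> obj G"
    then have "ole G (\<tau> x) (\<tau>' x)" using l(1) by blast
    then show "ole G ((\<lambda>x\<in>obj G. cmp G (g (\<tau> x)) (\<sigma> (tgt G (\<tau> x)))) x)
       ((\<lambda>x\<in>obj G. cmp G (g' (\<tau>' x)) (\<sigma>' (tgt G (\<tau>' x)))) x)"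
      using x by (simp add: OG2 g s D1(4) D2(4) D3(4,6) D4(4,6) F3 F4 ole_tgt groupoid_simps)
  qed
qed

theorem internal_monoid_OGPD: "internal_monoid E M"
proof -
  have "\<one>\<^bsub>M\<^esub> \<in> obj E"
    unfolding obj_def[of E] using one_closed
    by (auto simp: monoid_sel pair.OGPD_sel objD intro!: restrict_ext)
  moreover have "ordered_functor (prod_ogpd E E) E (\<lambda>(g, h). g \<otimes>\<^bsub>M\<^esub> h)"
  proof (rule ordered_functorI, goal_cases)
    case (1 a)
    then show ?case by (auto simp: prod_ogpd_def mult_closed)
  next
    case (2 a)
    then obtain f \<tau> g \<sigma> where a: "a = ((f, \<tau>), (g, \<sigma>))" "(f, \<tau>) \<in> arr E" "(g, \<sigma>) \<in> arr E"
      by (auto simp: prod_ogpd_def)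
    note D1 = pair.OGPD_arrD[OF a(2)] and D2 = pair.OGPD_arrD[OF a(3)]
    note F1 = ordered_functorD(1)[OF D1(2)] pair.functor_obj[OF D1(2)]
      and F2 = ordered_functorD(1)[OF D2(2)] pair.functor_obj[OF D2(2)]
    \<comment> \<open>The product formula gives the two source identities the second component
      \<open>g (f x)\<close> composed with itself; it collapses because \<open>g (f x)\<close> is an
      identity. The target case needs the same collapse.\<close>
    have "cmp G (g (f x)) (g (f x)) = g (f x)" if "x \<in> obj G" for x
      using cmp_src[of "g (f x)"] that by (simp add: F1 F2 objD)
    then show ?case
      by (auto simp: a(1) prod_ogpd_def monoid_sel pair.OGPD_sel compose_eq F1 F2 objD
          intro!: restrict_ext)
  next
    case (3 a)
    then obtain f \<tau> g \<sigma> where a: "a = ((f, \<tau>), (g, \<sigma>))" "(f, \<tau>) \<in> arr E" "(g, \<sigma>) \<in> arr E"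
      by (auto simp: prod_ogpd_def)
    note F1 = pair.nt_target_functor[OF a(2)] and F2 = pair.nt_target_functor[OF a(3)]
    note F1 = ordered_functorD(1)[OF F1] pair.functor_obj[OF F1]
      and F2 = ordered_functorD(1)[OF F2] pair.functor_obj[OF F2]
    let ?f = "nt_target G G f \<tau>" and ?g = "nt_target G G g \<sigma>"
    have "cmp G (?g (?f x)) (?g (?f x)) = ?g (?f x)" if "x \<in> obj G" for x
      using cmp_src[of "?g (?f x)"] that by (simp add: F1 F2 objD)
    then show ?case
      using nt_target_mult[OF a(2,3)]
      by (auto simp: a(1) prod_ogpd_def monoid_sel pair.OGPD_sel compose_eq F1 F2 objD
          intro!: restrict_ext)
  next
    case (4 a b)
    then obtain f \<tau> g \<sigma> f' \<tau>' g' \<sigma>'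
      where a: "a = ((f, \<tau>), (g, \<sigma>))" "(f, \<tau>) \<in> arr E" "(g, \<sigma>) \<in> arr E"
        and b: "b = ((f', \<tau>'), (g', \<sigma>'))" "(f', \<tau>') \<in> arr E" "(g', \<sigma>') \<in> arr E"
        and ab: "tgt E (f, \<tau>) = src E (f', \<tau>')" "tgt E (g, \<sigma>) = src E (g', \<sigma>')"
      by (auto simp: prod_ogpd_def)
    \<comment> \<open>Preservation of composition is the interchange law; the matching of targets
      and sources supplies its hypotheses on the functors.\<close>
    then show ?case
      using interchange[OF a(2) b(2) a(3) b(3)]
      by (simp add: prod_ogpd_def a(1) b(1) pair.OGPD_sel(1,2))
  next
    case (5 a b)
    then show ?case by (auto simp: prod_ogpd_def intro!: mult_mono)
  qed
  ultimately show ?thesis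
    unfolding internal_monoid_def
    by (simp add: pair.OGPD_ordered_groupoid monoid_OGPD monoid_sel(1))
qed

theorem right_monoid_action_OGPD: "right_monoid_action M (arr G) (OGPD_act G)"
  unfolding right_monoid_action_def
proof (intro conjI ballI)
  show "monoid M" by (rule monoid_OGPD)
  fix a assume a: "a \<in> arr G"
  show "OGPD_act G a \<one>\<^bsub>M\<^esub> = a"
    using a by (simp add: OGPD_act_def monoid_sel groupoid_simps)
  fix m assume m: "m \<in> carrier M"
  obtain f \<tau> where e: "m = (f, \<tau>)" by (cases m)
  have f\<tau>: "(f, \<tau>) \<in> arr E" using m by (simp add: e monoid_sel)
  note D = pair.OGPD_arrD[OF f\<tau>]
  show "OGPD_act G a m \<in> arr G"
    using a by (simp add: e OGPD_act_def D(4,6) ordered_functorD(1)[OF D(2)]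
        pair.functor_obj[OF D(2)] groupoid_simps)
  fix n assume "n \<in> carrier M"
  then show "OGPD_act G a (m \<otimes>\<^bsub>M\<^esub> n) = OGPD_act G (OGPD_act G a m) n"
    using act_mult[OF f\<tau> _ a] by (cases n) (simp only: e monoid_sel(1))
qed

end


section \<open>The holomorph\<close>

theorem theorem4p1:
  fixes S :: "'a semigrp" (structure)
  assumes "inverse_semigroup S"
  shows
    "arr (Hol S) = {(\<alpha>, \<tau>).
      \<alpha> \<in> carrier S \<rightarrow>\<^sub>E carrier S \<and> premorphism S \<alpha> \<and>
      \<tau> \<in> idems S \<rightarrow>\<^sub>E carrier S \<and>
      (\<forall>e\<in>idems S. \<forall>f\<in>idems S. e \<preceq> f \<longrightarrow> \<tau> e \<preceq> \<tau> f) \<and>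
      (\<forall>e\<in>idems S. \<tau> e \<cdot> sinv (\<tau> e) = \<alpha> e)} \<and>
    internal_monoid (Hol S) (Hol_monoid S) \<and>
    (\<forall>(\<alpha>, \<tau>)\<in>arr (Hol S). \<forall>(\<beta>, \<sigma>)\<in>arr (Hol S).
      (tgt (Hol S) (\<alpha>, \<tau>) = src (Hol S) (\<beta>, \<sigma>) \<longleftrightarrow>
        (\<forall>s\<in>carrier S. \<beta> s = sinv (\<tau> (s \<cdot> sinv s)) \<cdot> \<alpha> s \<cdot> \<tau> (sinv s \<cdot> s))) \<and>
      (tgt (Hol S) (\<alpha>, \<tau>) = src (Hol S) (\<beta>, \<sigma>) \<longrightarrow>
        cmp (Hol S) (\<alpha>, \<tau>) (\<beta>, \<sigma>) = (\<alpha>, \<lambda>e\<in>idems S. \<tau> e \<cdot> \<sigma> e))) \<and>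
    (\<forall>(\<alpha>, \<tau>)\<in>arr (Hol S). \<forall>(\<beta>, \<sigma>)\<in>arr (Hol S).
      (\<alpha>, \<tau>) \<otimes>\<^bsub>Hol_monoid S\<^esub> (\<beta>, \<sigma>) =
        (compose (carrier S) \<beta> \<alpha>,
         \<lambda>e\<in>idems S. \<beta> (\<tau> e) \<cdot> \<sigma> (sinv (\<tau> e) \<cdot> \<tau> e))) \<and>
    right_monoid_action (Hol_monoid S) (carrier S)
      (\<lambda>s (\<alpha>, \<tau>). \<alpha> s \<cdot> \<tau> (sinv s \<cdot> s))"
proof -
  interpret inverse_semigroup S by fact
  interpret V: ordered_groupoid "vec_ogpd S" by (rule ordered_groupoid_vec)
  \<comment> \<open>The components of \<open>\<tau>\<close> lie in the carrier, where
    \<open>ginv\<close> is \<open>sinv\<close>, so the conjugation formula becomes the expression in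
    the composability condition.\<close>
  have nt: "nt_target (vec_ogpd S) (vec_ogpd S) \<alpha> \<tau> =
      (\<lambda>s\<in>carrier S. sinv (\<tau> (s \<cdot> sinv s)) \<cdot> \<alpha> s \<cdot> \<tau> (sinv s \<cdot> s))"
    if "(\<alpha>, \<tau>) \<in> arr (Hol S)" for \<alpha> \<tau>
    using V.pair.OGPD_arrD(4)[OF that[unfolded Hol_def]]
    by (auto simp: nt_target_def vec_sel obj_vec ginv_vec mult_sinv_idem intro!: restrict_ext)
  have a: "arr (Hol S) = {(\<alpha>, \<tau>).
      \<alpha> \<in> carrier S \<rightarrow>\<^sub>E carrier S \<and> premorphism S \<alpha> \<and>
      \<tau> \<in> idems S \<rightarrow>\<^sub>E carrier S \<and>
      (\<forall>e\<in>idems S. \<forall>f\<in>idems S. e \<preceq> f \<longrightarrow> \<tau> e \<preceq> \<tau> f) \<and>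
      (\<forall>e\<in>idems S. \<tau> e \<cdot> sinv (\<tau> e) = \<alpha> e)}"
    unfolding Hol_def OGPD_def
    by (auto simp: vec_sel obj_vec ordered_functor_iff_premorphism premorphism_def PiE_def)
  have b: "tgt (Hol S) (\<alpha>, \<tau>) = src (Hol S) (\<beta>, \<sigma>) \<longleftrightarrow>
        (\<forall>s\<in>carrier S. \<beta> s = sinv (\<tau> (s \<cdot> sinv s)) \<cdot> \<alpha> s \<cdot> \<tau> (sinv s \<cdot> s))"
    if m: "(\<alpha>, \<tau>) \<in> arr (Hol S)" and n: "(\<beta>, \<sigma>) \<in> arr (Hol S)" for \<alpha> \<tau> \<beta> \<sigma>
  proof -
    \<comment> \<open>The second components of \<open>tgt\<close> and \<open>src\<close> are
      restrictions of the first ones, so only the functors have to agree; as extensional functions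
      they agree as soon as their values on the carrier do.\<close>
    have "tgt (Hol S) (\<alpha>, \<tau>) = src (Hol S) (\<beta>, \<sigma>) \<longleftrightarrow>
        nt_target (vec_ogpd S) (vec_ogpd S) \<alpha> \<tau> = \<beta>"
      unfolding Hol_def V.pair.OGPD_sel by auto
    also have "\<dots> \<longleftrightarrow> (\<forall>s\<in>carrier S. nt_target (vec_ogpd S) (vec_ogpd S) \<alpha> \<tau> s = \<beta> s)"
      using V.pair.OGPD_arrD(1)[OF n[unfolded Hol_def]]
      by (auto simp: vec_sel nt_target_def intro!: extensionalityI[of _ "carrier S"])
    finally show ?thesis by (auto simp: nt[OF m])
  qed
  have d: "right_monoid_action (Hol_monoid S) (carrier S)
      (\<lambda>s (\<alpha>, \<tau>). \<alpha> s \<cdot> \<tau> (sinv s \<cdot> s))"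
    using V.right_monoid_action_OGPD
    unfolding Hol_monoid_def vec_sel OGPD_act_def .
  have i: "internal_monoid (Hol S) (Hol_monoid S)"
    unfolding Hol_def Hol_monoid_def by (rule V.internal_monoid_OGPD)
  have c: "cmp (Hol S) (\<alpha>, \<tau>) (\<beta>, \<sigma>) = (\<alpha>, \<lambda>e\<in>idems S. \<tau> e \<cdot> \<sigma> e)" for \<alpha> \<tau> \<beta> \<sigma>
    unfolding Hol_def V.pair.OGPD_sel vec_sel obj_vec ..
  have m: "(\<alpha>, \<tau>) \<otimes>\<^bsub>Hol_monoid S\<^esub> (\<beta>, \<sigma>) =
        (compose (carrier S) \<beta> \<alpha>,
         \<lambda>e\<in>idems S. \<beta> (\<tau> e) \<cdot> \<sigma> (sinv (\<tau> e) \<cdot> \<tau> e))" for \<alpha> \<tau> \<beta> \<sigma>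
    unfolding Hol_monoid_def V.monoid_sel vec_sel obj_vec ..
  show ?thesis
    by (intro conjI a i d) (use b c m in blast)+
qed

end
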